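(* Let $(A,b,c)$ be a discrete-time state-space system with $A\in\mathbb{R}^{n\times n}$ stable and $b,c^{\mathsf T}\in\mathbb{R}^n$, and let $1\le k\le n$. Then $(A,b,c)$ is internally Hankel $k$-positive if and only if for every $1\le j\le k$ the realization $$\big(A_{[j]},\ \mathcal{C}^j(A,b)_{[j]},\ \mathcal{O}^j(A,c)_{[j]}\big)$$ of the $j$-th compound system is internally positive.
   Context: The system is $x(t+1)=Ax(t)+bu(t)$, $y(t)=cx(t)$; $A$ stable means that all its eigenvalues lie in the open unit disc. Compounds: for $X\in\mathbb{R}^{n\times m}$ and $r\le\min\{n,m\}$, $X_{[r]}\in\mathbb{R}^{\binom nr\times\binom mr}$ is the matrix of all $r\times r$ minors $\det(X_{I,J})$, with the $r$-element index sets $I,J$ ordered lexicographically. $\mathcal{C}^j(A,b)=\begin{pmatrix} b & Ab&\cdots&A^{j-1}b\end{pmatrix}$, and $\mathcal{O}^j(A,c)=\mathcal{C}^j(A^{\mathsf T},c^{\mathsf T})^{\mathsf T}$ has rows $c,cA,\dots,cA^{j-1}$. Internal positivity: a triple $(F,g,h)$ is internally positive if for every input $u(t)\ge0$ ($t\ge 0$) and every $x(0)\ge 0$ (entrywise), the solution of $x(t+1)=Fx(t)+gu(t)$, $y(t)=hx(t)$ satisfies $x(t)\ge0$ and $y(t)\ge 0$ for all $t\ge0$. Variation: for a real vector or sequence $u$, $S(u)$ is the number of sign changes in $u$ after deleting all zero entries, with $S(0)=0$. A linear map $X$ is order-preserving $m$-variation diminishing ($\mathrm{OVD}_m$), $m\ge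 0$, if for all $u$ with $S(u)\le m$: (1) $S(Xu)\le S(u)$; and (2) whenever $S(Xu)=S(u)$, the signs of the first nonzero elements of $u$ and $Xu$ coincide (void if $u$ or $Xu$ is zero). Operators: $\mathcal{C}(A,b)u=\sum_{t=-\infty}^{-1}A^{-t-1}b\,u(t)$ for bounded $u$, where the past input is ordered as the sequence $(u(-1),u(-2),u(-3),\dots)$; and $(\mathcal{O}(A,c)x_0)(t)=cA^tx_0$ for $x_0\in\mathbb{R}^n$, $t=0,1,2,\dots$. $(A,b,c)$ is internally Hankel $k$-positive ($k\ge1$) if the linear maps $A$, $\mathcal{C}(A,b)$ and $\mathcal{O}(A,c)$ are all $\mathrm{OVD}_{k-1}$. *)

theory Defs
  imports
    "HOL-Analysis.Elementary_Metric_Spaces"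
    "HOL-Analysis.Infinite_Sum"
    "HOL-Library.Extended_Nat"
    "HOL-Library.List_Lexorder"
    "Jordan_Normal_Form.Char_Poly"
    "Jordan_Normal_Form.DL_Submatrix"
begin

text \<open>
  Indices start at 0. A single-input single-output system \<open>(A, b, c)\<close> of order \<open>n\<close> consists of
  an \<open>n \<times> n\<close> matrix \<open>A\<close>, an \<open>n \<times> 1\<close> matrix \<open>b\<close> and a \<open>1 \<times> n\<close> matrix \<open>c\<close>.
\<close>

definition stable :: "real mat \<Rightarrow> bool" where
  "stable A \<longleftrightarrow> (\<forall>z. eigenvalue (map_mat complex_of_real A) z \<longrightarrow> cmod z < 1)"


subsection \<open>Compound matrices\<close>

text \<open>
  An index set is represented by the increasing list of its elements; the outer
  \<^const>\<open>sorted_list_of_set\<close> sorts these lists by the lexicographic order on lists.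
\<close>

definition lex_subsets :: "nat \<Rightarrow> nat \<Rightarrow> nat list list" where
  "lex_subsets n r =
     sorted_list_of_set (sorted_list_of_set ` {I. I \<subseteq> {0..<n} \<and> card I = r})"

lemma length_lex_subsets: "length (lex_subsets n r) = n choose r"
proof -
  have "inj_on sorted_list_of_set {I. I \<subseteq> {0..<n} \<and> card I = r}"
    by (rule inj_onI) (metis (mono_tags, lifting) finite_atLeastLessThan finite_subset
        mem_Collect_eq sorted_list_of_set.set_sorted_key_list_of_set)
  then show ?thesis
    by (simp add: lex_subsets_def card_image n_subsets)
qed

definition compound :: "nat \<Rightarrow> real mat \<Rightarrow> real mat" where
  "compound r X = mat (dim_row X choose r) (dim_col X choose r)
     (\<lambda>(i, j). det (submatrix X (set (lex_subsets (dim_row X) r ! i))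
                               (set (lex_subsets (dim_col X) r ! j))))"


subsection \<open>Controllability and observability matrices\<close>

definition ctrb_mat :: "nat \<Rightarrow> real mat \<Rightarrow> real mat \<Rightarrow> real mat" where
  "ctrb_mat j A b = mat (dim_row A) j (\<lambda>(i, l). (A ^\<^sub>m l * b) $$ (i, 0))"

definition obsv_mat :: "nat \<Rightarrow> real mat \<Rightarrow> real mat \<Rightarrow> real mat" where
  "obsv_mat j A c = transpose_mat (ctrb_mat j (transpose_mat A) (transpose_mat c))"


subsection \<open>Internal positivity\<close>

primrec state_traj ::
  "real mat \<Rightarrow> real mat \<Rightarrow> real vec \<Rightarrow> (nat \<Rightarrow> real) \<Rightarrow> nat \<Rightarrow> real vec" where
  "state_traj F g x0 u 0 = x0"
| "state_traj F g x0 u (Suc t) = F *\<^sub>v state_traj F g x0 u t + u t \<cdot>\<^sub>v col g 0"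

definition internally_positive :: "real mat \<Rightarrow> real mat \<Rightarrow> real mat \<Rightarrow> bool" where
  "internally_positive F g h \<longleftrightarrow>
     (\<forall>u x0. (\<forall>t. 0 \<le> u t) \<longrightarrow> x0 \<in> carrier_vec (dim_row F) \<longrightarrow> 0\<^sub>v (dim_row F) \<le> x0 \<longrightarrow>
        (\<forall>t. 0\<^sub>v (dim_row F) \<le> state_traj F g x0 u t \<and>
             0 \<le> (h *\<^sub>v state_traj F g x0 u t) $ 0))"


subsection \<open>Sign variation\<close>

text \<open>
  After deletion of the zero entries, the entries \<open>u i\<close> and \<open>u j\<close> with \<open>i < j\<close> become adjacent
  iff both are nonzero and all entries strictly between them vanish. The number of sign changes
  of an infinite sequence may be infinite.
\<close>

definition sign_changes :: "(nat \<Rightarrow> real) \<Rightarrow> (nat \<times> nat) set" where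
  "sign_changes u = {(i, j). i < j \<and> u i * u j < 0 \<and> (\<forall>l. i < l \<and> l < j \<longrightarrow> u l = 0)}"

definition variation :: "(nat \<Rightarrow> real) \<Rightarrow> enat" where
  "variation u = (if finite (sign_changes u) then enat (card (sign_changes u)) else \<infinity>)"

definition first_sign :: "(nat \<Rightarrow> real) \<Rightarrow> real" where
  "first_sign u = sgn (u (LEAST i. u i \<noteq> 0))"

text \<open>Padding a vector with zeros changes neither its variation nor its first nonzero entry.\<close>

definition vec_seq :: "real vec \<Rightarrow> nat \<Rightarrow> real" where
  "vec_seq v i = (if i < dim_vec v then v $ i else 0)"

text \<open>
  \<open>ovd m D \<sigma> \<tau> X\<close>: the map \<open>X\<close> with domain \<open>D\<close> is order-preserving \<open>m\<close>-variation diminishing,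
  where \<open>\<sigma>\<close> and \<open>\<tau>\<close> read arguments and values of \<open>X\<close> as sequences.
\<close>

definition ovd ::
  "nat \<Rightarrow> 'a set \<Rightarrow> ('a \<Rightarrow> nat \<Rightarrow> real) \<Rightarrow> ('b \<Rightarrow> nat \<Rightarrow> real) \<Rightarrow> ('a \<Rightarrow> 'b) \<Rightarrow> bool" where
  "ovd m D \<sigma> \<tau> X \<longleftrightarrow>
     (\<forall>u\<in>D. variation (\<sigma> u) \<le> enat m \<longrightarrow>
        variation (\<tau> (X u)) \<le> variation (\<sigma> u) \<and>
        (variation (\<tau> (X u)) = variation (\<sigma> u) \<longrightarrow>
         (\<exists>i. \<sigma> u i \<noteq> 0) \<longrightarrow> (\<exists>i. \<tau> (X u) i \<noteq> 0) \<longrightarrow>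
         first_sign (\<sigma> u) = first_sign (\<tau> (X u))))"


subsection \<open>Internal Hankel positivity\<close>

text \<open>
  Past inputs are functions \<open>u :: int \<Rightarrow> real\<close> of which only the values at negative times are used.
  The sum over the past converges absolutely if \<open>A\<close> is stable and \<open>u\<close> is bounded
  (\<^const>\<open>infsum\<close> is 0 for families that are not summable).
\<close>

definition past_inputs :: "(int \<Rightarrow> real) set" where
  "past_inputs = {u. bounded (u ` {..-1})}"

definition past_seq :: "(int \<Rightarrow> real) \<Rightarrow> nat \<Rightarrow> real" where
  "past_seq u k = u (- 1 - int k)"

definition ctrb_op :: "real mat \<Rightarrow> real mat \<Rightarrow> (int \<Rightarrow> real) \<Rightarrow> real vec" where
  "ctrb_op A b u = vec (dim_row A)
     (\<lambda>i. \<Sum>\<^sub>\<infinity>t\<in>{..-1}. (A ^\<^sub>m nat (- t - 1) * b) $$ (i, 0) * u t)"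

definition obsv_op :: "real mat \<Rightarrow> real mat \<Rightarrow> real vec \<Rightarrow> nat \<Rightarrow> real" where
  "obsv_op A c x0 t = (c * A ^\<^sub>m t *\<^sub>v x0) $ 0"

definition internally_Hankel_positive :: "nat \<Rightarrow> real mat \<Rightarrow> real mat \<Rightarrow> real mat \<Rightarrow> bool" where
  "internally_Hankel_positive k A b c \<longleftrightarrow>
     ovd (k - 1) (carrier_vec (dim_row A)) vec_seq vec_seq (\<lambda>x. A *\<^sub>v x) \<and>
     ovd (k - 1) past_inputs past_seq vec_seq (ctrb_op A b) \<and>
     ovd (k - 1) (carrier_vec (dim_row A)) vec_seq (\<lambda>y. y) (obsv_op A c)"

end

theory Submission
  imports Defs "Jordan_Normal_Form.Spectral_Radius"
begin

text \<open>
  A map given by a (possibly infinite) matrix is \<open>OVD\<^sub>m\<close> iff all its minors of order at most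
  \<open>m + 1\<close> are nonnegative. Hence internal Hankel \<open>k\<close>-positivity says that the minors of order at
  most \<open>k\<close> of \<open>A\<close>, of the infinite controllability matrix \<open>(b, A b, A\<^sup>2 b, \<dots>)\<close> and of the infinite
  observability matrix are nonnegative, while internal positivity of the compound realizations
  only involves \<open>A\<close> and the first \<open>j\<close> columns of the controllability matrix (dually for the
  observability matrix). By Cauchy--Binet, multiplication by \<open>A\<close> carries
  nonnegativity from the first \<open>j\<close> columns to any \<open>j\<close> consecutive columns. Arbitrary columns are
  reached by Fekete's induction on the spread of the columns, based on a three-term Pluecker
  relation. It needs strict positivity, which is gained by multiplying from the left with a
  strictly totally positive matrix close to the identity; the consecutive minors that still
  vanish do so because the Krylov space has degenerated, and then all later minors of the
  same order vanish too.
\<close>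

subsection \<open>Minors and the Cauchy--Binet formula\<close>

text \<open>Fekete's induction divides by a minor of lower order, so it breaks down at zeros.
  Perturbing \<open>A\<close> or \<open>b\<close> would have to respect all compounds at once; the
  finished Krylov matrix is perturbed instead. A left factor mixes rows only and so keeps every
  linear relation between columns. By Cauchy--Binet, a minor of the product in consecutive columns
  is a combination, with strictly positive weights, of the nonnegative minors of the original in the
  same columns. It is therefore positive for every choice of rows or zero for every choice. This
  dichotomy replaces strict positivity: a minor of the product is positive unless, from some column
  on, its remaining columns lie in a degenerate part of the Krylov sequence. On the operator side, a
  failure of either OVD clause produces strictly alternating outputs of the wrong leading sign.
  Strictness at finitely many rows survives truncation of the series, so a finite matrix argument
  covers the infinite matrices. An order-\<open>r\<close> minor corresponds to inputs with
  \<open>r - 1\<close> sign changes, which is the origin of the shift between \<open>k\<close> and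
  \<open>k - 1\<close>.\<close>

text \<open>
  Rows and columns are selected by index functions, of which only the values below \<open>r\<close> matter;
  the positivity conditions below use strictly increasing ones.
\<close>

definition minor :: "nat \<Rightarrow> (nat \<Rightarrow> nat \<Rightarrow> real) \<Rightarrow> (nat \<Rightarrow> nat) \<Rightarrow> (nat \<Rightarrow> nat) \<Rightarrow> real" where
  "minor r M R C = det (mat r r (\<lambda>(i, j). M (R i) (C j)))"

lemma minor_eq_sum:
  "minor r M R C = (\<Sum>p | p permutes {0..<r}. signof p * (\<Prod>i = 0..<r. M (R i) (C (p i))))"
proof -
  have "p i < r" if "p permutes {0..<r}" "i < r" for p i
    using permutes_in_image[OF that(1), of i] that(2) by simp
  then show ?thesis
    by (auto simp: minor_def det_def intro!: sum.cong prod.cong)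
qed

lemma minor_0 [simp]: "minor 0 M R C = 1"
  by (simp add: minor_def det_def)

lemma minor_cong:
  assumes "\<And>i j. i < r \<Longrightarrow> j < r \<Longrightarrow> M (R i) (C j) = M' (R' i) (C' j)"
  shows "minor r M R C = minor r M' R' C'"
  unfolding minor_def using assms by (intro arg_cong[where f = det] eq_matI) auto

lemma minor_transpose: "minor r M R C = minor r (\<lambda>i j. M j i) C R"
proof -
  have "mat r r (\<lambda>(i, j). M (R j) (C i)) = transpose_mat (mat r r (\<lambda>(i, j). M (R i) (C j)))"
    by (rule eq_matI) auto
  then show ?thesis
    unfolding minor_def by (metis det_transpose mat_carrier)
qed

section \<open>Laplace expansion and vanishing determinants\<close>

lemma minor_expand_col:
  assumes "j < Suc r"
  shows "minor (Suc r) M R C =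
    (\<Sum>i<Suc r. (-1) ^ (i + j) * M (R i) (C j) * minor r M (R \<circ> insert_index i) (C \<circ> insert_index j))"
proof -
  let ?A = "mat (Suc r) (Suc r) (\<lambda>(i, j). M (R i) (C j))"
  have "mat_delete ?A i j = mat r r (\<lambda>(a, b). M (R (insert_index i a)) (C (insert_index j b)))"
    if "i < Suc r" for i
    using that assms by (intro eq_matI) (auto simp: mat_delete_def insert_index_def)
  then show ?thesis
    unfolding minor_def by (subst laplace_expansion_column[of ?A "Suc r" j])
      (use assms in \<open>auto simp: cofactor_def intro!: sum.cong\<close>)
qed

lemma minor_expand_row:
  assumes "i < Suc r"
  shows "minor (Suc r) M R C =
    (\<Sum>j<Suc r. (-1) ^ (i + j) * M (R i) (C j) * minor r M (R \<circ> insert_index i) (C \<circ> insert_index j))"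
proof -
  have "minor (Suc r) M R C = minor (Suc r) (\<lambda>i j. M j i) C R"
    by (rule minor_transpose)
  also have "\<dots> = (\<Sum>j<Suc r. (-1) ^ (j + i) * M (R i) (C j) *
      minor r (\<lambda>i j. M j i) (C \<circ> insert_index j) (R \<circ> insert_index i))"
    by (rule minor_expand_col[OF assms])
  finally show ?thesis
    by (subst minor_transpose) (simp add: add.commute)
qed

lemma minor_identical_rows:
  assumes "i < r" "j < r" "i \<noteq> j" "\<And>l. l < r \<Longrightarrow> M (R i) (C l) = M (R j) (C l)"
  shows "minor r M R C = 0"
  unfolding minor_def
  by (rule det_identical_rows[where i = i and j = j and n = r]) (use assms in \<open>auto intro!: eq_vecI\<close>)

lemma minor_identical_cols:
  assumes "i < r" "j < r" "i \<noteq> j" "\<And>l. l < r \<Longrightarrow> M (R l) (C i) = M (R l) (C j)"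
  shows "minor r M R C = 0"
  by (subst minor_transpose) (rule minor_identical_rows[of i r j], use assms in auto)

lemma minor_zero_col:
  assumes "j < r" "\<And>l. l < r \<Longrightarrow> M (R l) (C j) = 0"
  shows "minor r M R C = 0"
proof (cases r)
  case (Suc s)
  then show ?thesis using assms by (simp only: minor_expand_col[of j s]) simp
qed (use assms in simp)

lemma minor_zero_row:
  assumes "i < r" "\<And>l. l < r \<Longrightarrow> M (R i) (C l) = 0"
  shows "minor r M R C = 0"
  by (subst minor_transpose) (rule minor_zero_col[of i], use assms in auto)

lemma minor_permute_rows:
  assumes "p permutes {0..<r}"
  shows "minor r M (R \<circ> p) C = signof p * minor r M R C"
proof -
  have "p i < r" if "i < r" for i
    using permutes_in_image[OF assms(1), of i] that by simp
  then have "mat r r (\<lambda>(i, j). M ((R \<circ> p) i) (C j)) =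
      mat r r (\<lambda>(i, j). mat r r (\<lambda>(i, j). M (R i) (C j)) $$ (p i, j))"
    by (intro eq_matI) auto
  then show ?thesis
    unfolding minor_def using det_permute_rows[OF _ assms, of "mat r r (\<lambda>(i, j). M (R i) (C j))"] by simp
qed

text \<open>The adjugate identity. For \<open>l\<close> different from \<open>i\<close> the sum
  expands the determinant in which row \<open>i\<close> is replaced by row \<open>l\<close>: the
  cofactors are unchanged and two rows agree.\<close>

lemma cofactor_sum:
  assumes "i < Suc r" "l < Suc r"
  shows "(\<Sum>j<Suc r. (-1) ^ (i + j) * M (R l) (C j) * minor r M (R \<circ> insert_index i) (C \<circ> insert_index j))
    = (if l = i then minor (Suc r) M R C else 0)"
proof (cases "l = i")
  case True
  then show ?thesis using minor_expand_row[OF assms(1)] by simp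
next
  case False
  let ?R = "R(i := R l)"
  have "minor (Suc r) M ?R C = 0"
    by (rule minor_identical_rows[of i _ l]) (use assms False in auto)
  moreover have "?R \<circ> insert_index i = R \<circ> insert_index i"
    by (auto simp: insert_index_def)
  ultimately show ?thesis
    using minor_expand_row[OF assms(1), of M ?R C] False by simp
qed

lemma cofactor_sum_col:
  assumes "j < Suc r" "l < Suc r"
  shows "(\<Sum>i<Suc r. (-1) ^ (i + j) * M (R i) (C l) * minor r M (R \<circ> insert_index i) (C \<circ> insert_index j))
    = (if l = j then minor (Suc r) M R C else 0)"
  using cofactor_sum[OF assms, of "\<lambda>i j. M j i" C R]
  by (simp only: minor_transpose[of _ M, symmetric] add.commute)

section \<open>Increasing enumerations of finite index sets\<close>

lemma strict_mono_on_pick: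
  assumes "card L = r"
  shows "strict_mono_on {..<r} (pick L)"
  by (rule strict_mono_onI) (use assms in \<open>auto intro!: pick_mono_le\<close>)

lemma pick_image:
  assumes "finite L" "card L = r"
  shows "pick L ` {..<r} = L"
proof
  show "pick L ` {..<r} \<subseteq> L"
    using assms by (auto intro: pick_in_set_le)
  show "L \<subseteq> pick L ` {..<r}"
  proof
    fix x assume x: "x \<in> L"
    then have "card {a \<in> L. a < x} < card L"
      using assms by (intro psubset_card_mono) auto
    then show "x \<in> pick L ` {..<r}"
      using assms by (intro image_eqI[of _ _ "card {a \<in> L. a < x}"]) (simp_all add: pick_card_in_set[OF x])
  qed
qed

lemma pick_strict_mono_image:
  assumes "strict_mono_on {..<r} R" "i < r"
  shows "pick (R ` {..<r}) i = R i"
proof -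
  have inj: "inj_on R {..<r}"
    using assms(1) by (rule strict_mono_on_imp_inj_on)
  have "R a < R i \<longleftrightarrow> a < i" if "a < r" for a
    using assms that by (metis lessThan_iff linorder_neqE_nat order_less_asym strict_mono_onD)
  then have "{a \<in> R ` {..<r}. a < R i} = R ` {..<i}"
    using assms(2) by force
  moreover have "card (R ` {..<i}) = i"
    using assms(2) by (simp add: card_image inj_on_subset[OF inj])
  ultimately show ?thesis
    using pick_card_in_set[of "R i" "R ` {..<r}"] assms(2) by simp
qed

text \<open>Multilinearity in the rows: \<open>f\<close> records which summand is taken in each row.
  At this stage \<open>f\<close> need not be injective.\<close>

lemma minor_sum_prod:
  "minor r (\<lambda>i j. \<Sum>l<n. P i l * Q l j) R C =
    (\<Sum>f\<in>{0..<r} \<rightarrow>\<^sub>E {..<n}. (\<Prod>i = 0..<r. P (R i) (f i)) * minor r Q f C)"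
proof -
  have "minor r (\<lambda>i j. \<Sum>l<n. P i l * Q l j) R C =
    (\<Sum>p | p permutes {0..<r}. \<Sum>f\<in>{0..<r} \<rightarrow>\<^sub>E {..<n}.
      signof p * (\<Prod>i = 0..<r. P (R i) (f i) * Q (f i) (C (p i))))"
    by (simp add: minor_eq_sum prod_sum_PiE sum_distrib_left)
  also have "\<dots> = (\<Sum>f\<in>{0..<r} \<rightarrow>\<^sub>E {..<n}. \<Sum>p | p permutes {0..<r}.
      signof p * (\<Prod>i = 0..<r. P (R i) (f i) * Q (f i) (C (p i))))"
    by (rule sum.swap)
  also have "\<dots> = (\<Sum>f\<in>{0..<r} \<rightarrow>\<^sub>E {..<n}. (\<Prod>i = 0..<r. P (R i) (f i)) * minor r Q f C)"
    by (simp add: minor_eq_sum prod.distrib sum_distrib_left mult_ac)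
  finally show ?thesis .
qed

theorem Cauchy_Binet_minor:
  "minor r (\<lambda>i j. \<Sum>l<n. P i l * Q l j) R C =
    (\<Sum>L | L \<subseteq> {..<n} \<and> card L = r. minor r P R (pick L) * minor r Q (pick L) C)"
proof -
  let ?F = "{0..<r} \<rightarrow>\<^sub>E {..<n}"
  let ?S = "{L. L \<subseteq> {..<n} \<and> card L = r}"
  let ?P = "{p. p permutes {0..<r}}"
  let ?g = "\<lambda>f. (\<Prod>i = 0..<r. P (R i) (f i)) * minor r Q f C"
  have fin: "finite L" if "L \<in> ?S" for L
    using that by (auto intro: finite_subset)
  have noninj: "minor r Q f C = 0" if ni: "\<not> inj_on f {0..<r}" for f
  proof -
    obtain i j where "i < r" "j < r" "i \<noteq> j" "f i = f j"
      using ni unfolding inj_on_def by auto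
    then show ?thesis by (intro minor_identical_rows[of i _ j]) auto
  qed
  have bound: "p i < r" if "p permutes {0..<r}" "i < r" for p i
    using permutes_in_image[OF that(1), of i] that(2) by simp
  have pick_bound: "pick L i < n" if "L \<in> ?S" "i < r" for L i
    using that pick_in_set_le[of i L] by auto
  have "minor r (\<lambda>i j. \<Sum>l<n. P i l * Q l j) R C = sum ?g {f \<in> ?F. inj_on f {0..<r}}"
    unfolding minor_sum_prod by (rule sum.mono_neutral_right) (auto simp: noninj intro: finite_PiE)
  \<comment> \<open>An injective \<open>f\<close> factors uniquely as
    \<open>pick L \<circ> p\<close>, where \<open>L\<close> is its image and \<open>p i\<close> is
    the rank of \<open>f i\<close> in \<open>L\<close>. For fixed \<open>L\<close> the signed
    products over \<open>p\<close> then add up to the minor of \<open>P\<close>.\<close>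
  also have "\<dots> = (\<Sum>(L, p)\<in>?S \<times> ?P.
      (\<Prod>i = 0..<r. P (R i) (pick L (p i))) * (signof p * minor r Q (pick L) C))"
  proof (rule sum.reindex_bij_witness
      [where j = "\<lambda>f. (f ` {0..<r}, \<lambda>i. if i < r then card {a \<in> f ` {0..<r}. a < f i} else i)"
        and i = "\<lambda>(L, p). restrict (pick L \<circ> p) {0..<r}"])
    fix f assume f: "f \<in> {f \<in> ?F. inj_on f {0..<r}}"
    let ?L = "f ` {0..<r}"
    let ?p = "\<lambda>i. if i < r then card {a \<in> ?L. a < f i} else i"
    have pk: "pick ?L (?p i) = f i" if "i < r" for i
      using that by (auto intro!: pick_card_in_set)
    have cL: "card ?L = r"
      using f by (simp add: card_image)
    have "?p i < r" if "i < r" for i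
    proof -
      have "card {a \<in> ?L. a < f i} < card ?L"
        using that by (intro psubset_card_mono) auto
      then show ?thesis using that cL by simp
    qed
    moreover have "inj_on ?p {0..<r}"
    proof (rule inj_onI)
      fix x y assume "x \<in> {0..<r}" "y \<in> {0..<r}" "?p x = ?p y"
      then have "f x = f y" using pk[of x, symmetric] pk[of y, symmetric] by simp
      then show "x = y" using f \<open>x \<in> _\<close> \<open>y \<in> _\<close> by (auto dest: inj_onD)
    qed
    ultimately have perm: "?p permutes {0..<r}"
      by (intro inj_on_nat_permutes) auto
    show "(case (?L, ?p) of (L, p) \<Rightarrow> restrict (pick L \<circ> p) {0..<r}) = f"
      using f pk by (auto simp: restrict_def PiE_def extensional_def fun_eq_iff)
    show "(?L, ?p) \<in> ?S \<times> ?P"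
      using f cL perm by (auto simp: PiE_def Pi_def)
    have "minor r Q f C = minor r Q (pick ?L \<circ> ?p) C"
      using pk by (intro minor_cong) auto
    then show "(case (?L, ?p) of (L, p) \<Rightarrow>
        (\<Prod>i = 0..<r. P (R i) (pick L (p i))) * (signof p * minor r Q (pick L) C)) = ?g f"
      using pk minor_permute_rows[OF perm] by simp
  next
    fix x assume x: "x \<in> ?S \<times> ?P"
    obtain L p where Lp: "x = (L, p)" "L \<in> ?S" "p permutes {0..<r}"
      using x by auto
    let ?f = "restrict (pick L \<circ> p) {0..<r}"
    have img: "?f ` {0..<r} = L"
    proof -
      have "?f ` {0..<r} = pick L ` (p ` {0..<r})" by auto
      also have "\<dots> = L"
        using permutes_image[OF Lp(3)] pick_image[of L r] Lp(2) fin[OF Lp(2)]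
        by (simp add: atLeast0LessThan)
      finally show ?thesis .
    qed
    have "(if i < r then card {a \<in> ?f ` {0..<r}. a < ?f i} else i) = p i" for i
    proof (cases "i < r")
      case True
      then show ?thesis unfolding img using card_pick_le[of "p i" L] bound[OF Lp(3), of i] Lp(2) by simp
    next
      case False
      then show ?thesis using Lp(3) by (simp add: permutes_not_in)
    qed
    then show "((case x of (L, p) \<Rightarrow> restrict (pick L \<circ> p) {0..<r}) ` {0..<r},
        \<lambda>i. if i < r then card {a \<in> (case x of (L, p) \<Rightarrow> restrict (pick L \<circ> p) {0..<r}) ` {0..<r}.
          a < (case x of (L, p) \<Rightarrow> restrict (pick L \<circ> p) {0..<r}) i} else i) = x"
      using img unfolding Lp(1) prod.case by blast
    have "card (?f ` {0..<r}) = r" using img Lp(2) by auto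
    then have "inj_on ?f {0..<r}" by (simp add: eq_card_imp_inj_on)
    then show "(case x of (L, p) \<Rightarrow> restrict (pick L \<circ> p) {0..<r}) \<in> {f \<in> ?F. inj_on f {0..<r}}"
      using pick_bound[OF Lp(2)] bound[OF Lp(3)] by (auto simp: Lp(1))
  qed
  also have "\<dots> = (\<Sum>L\<in>?S. \<Sum>p\<in>?P.
      (\<Prod>i = 0..<r. P (R i) (pick L (p i))) * (signof p * minor r Q (pick L) C))"
    by (rule sum.cartesian_product[symmetric])
  also have "\<dots> = (\<Sum>L\<in>?S. minor r P R (pick L) * minor r Q (pick L) C)"
    by (simp add: minor_eq_sum[of r P] sum_distrib_right sum_distrib_left mult_ac)
  finally show ?thesis .
qed

subsection \<open>Minors and alternating patterns\<close>

lemma strict_mono_insert_index: "strict_mono (insert_index l)"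
  by (rule strict_monoI) (auto simp: insert_index_def)

lemma sum_insert_index:
  fixes f :: "nat \<Rightarrow> real"
  assumes "l < Suc n" "f l = 0"
  shows "(\<Sum>j<Suc n. f j) = (\<Sum>j<n. f (insert_index l j))"
proof -
  have "(\<Sum>j<Suc n. f j) = sum f (insert_index l ` {0..<n})"
    unfolding insert_index_image[OF assms(1)]
    by (rule sum.mono_neutral_right) (use assms in auto)
  then show ?thesis
    by (simp add: sum.reindex[OF insert_index_inj_on] atLeast0LessThan)
qed

lemma minor_zero_kernel:
  assumes "minor n M (\<lambda>i. i) (\<lambda>j. j) = 0"
  obtains z j where "j < n" "z j \<noteq> 0" "\<And>i. i < n \<Longrightarrow> (\<Sum>j<n. M i j * z j) = 0"
proof -
  let ?A = "mat n n (\<lambda>(i, j). M i j)"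
  obtain v where v: "v \<in> carrier_vec n" "v \<noteq> 0\<^sub>v n" "?A *\<^sub>v v = 0\<^sub>v n"
    using assms det_0_iff_vec_prod_zero[of ?A n] unfolding minor_def by auto
  then obtain j where "j < n" "v $ j \<noteq> 0"
    by (metis carrier_vecD eq_vecI index_zero_vec)
  moreover have "(\<Sum>j<n. M i j * v $ j) = 0" if "i < n" for i
  proof -
    have "(\<Sum>j<n. M i j * v $ j) = (?A *\<^sub>v v) $ i"
      using that v(1) by (auto simp: scalar_prod_def atLeast0LessThan intro!: sum.cong)
    then show ?thesis using v(3) that by simp
  qed
  ultimately show thesis using that[of j "\<lambda>j. v $ j"] by blast
qed

text \<open>The ratio test of linear programming. One of \<open>z\<close> and \<open>- z\<close>
  pushes entry \<open>j0\<close> towards the boundary of the orthant with signs \<open>s\<close>;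
  the smallest ratio over all entries pushed that way is the first time one of them vanishes, and
  until then no sign is violated.\<close>

lemma move_to_boundary:
  fixes s u z :: "nat \<Rightarrow> real"
  assumes u: "\<And>j. j < n \<Longrightarrow> 0 \<le> s j * u j" and s: "\<And>j. s j \<noteq> 0"
    and z: "j0 < n" "z j0 \<noteq> 0"
  obtains t l where "l < n" "u l + t * z l = 0" "\<And>j. j < n \<Longrightarrow> 0 \<le> s j * (u j + t * z j)"
proof -
  have *: "\<exists>t l. l < n \<and> u l + t * y l = 0 \<and> (\<forall>j<n. 0 \<le> s j * (u j + t * y j))"
    if y: "j1 < n" "s j1 * y j1 < 0" for y j1
  proof -
    let ?J = "{j. j < n \<and> s j * y j < 0}"
    let ?q = "\<lambda>j. (s j * u j) / - (s j * y j)"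
    have J: "finite ?J" "?J \<noteq> {}" using y by auto
    define t where "t = Min (?q ` ?J)"
    have "t \<in> ?q ` ?J"
      unfolding t_def by (rule Min_in) (use J in auto)
    then obtain l where l: "l < n" "s l * y l < 0" "t = ?q l" by auto
    have "0 \<le> t" unfolding l(3) using u[OF l(1)] l(2) by (intro divide_nonneg_nonneg) auto
    have "0 \<le> s j * (u j + t * y j)" if j: "j < n" for j
    proof (cases "s j * y j < 0")
      case True
      then have "t \<le> ?q j"
        unfolding t_def using j by (intro Min_le) auto
      then have "t * - (s j * y j) \<le> s j * u j"
        using True by (subst (asm) pos_le_divide_eq) auto
      then show ?thesis by (simp add: algebra_simps)
    next
      case False
      then have "0 \<le> t * (s j * y j)" using \<open>0 \<le> t\<close> by simp
      then show ?thesis using u[OF j] by (simp add: algebra_simps)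
    qed
    moreover have "u l + t * y l = 0"
      unfolding l(3) using s[of l] l(2) by (auto simp: field_simps)
    ultimately show ?thesis using l(1) by blast
  qed
  consider "s j0 * z j0 < 0" | "s j0 * - z j0 < 0"
    using s[of j0] z(2) by (smt (verit) mult_minus_right no_zero_divisors)
  then show thesis
  proof cases
    case 1
    then show ?thesis using *[OF z(1), of z] that by blast
  next
    case 2
    then obtain t l where "l < n" "u l + t * - z l = 0" "\<forall>j<n. 0 \<le> s j * (u j + t * - z j)"
      using *[OF z(1), of "\<lambda>j. - z j"] by blast
    then show ?thesis using that[of l "- t"] by simp
  qed
qed

text \<open>Total nonnegativity of order \<open>k\<close>. The index sets allow finite blocks,
  half-infinite and infinite matrices to be treated uniformly.\<close>

definition all_minors_nonneg :: "nat \<Rightarrow> nat set \<Rightarrow> nat set \<Rightarrow> (nat \<Rightarrow> nat \<Rightarrow> real) \<Rightarrow> bool" where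
  "all_minors_nonneg k I J M \<longleftrightarrow> (\<forall>r\<le>k. \<forall>R C. strict_mono_on {..<r} R \<longrightarrow> strict_mono_on {..<r} C \<longrightarrow>
     R ` {..<r} \<subseteq> I \<longrightarrow> C ` {..<r} \<subseteq> J \<longrightarrow> 0 \<le> minor r M R C)"

lemma all_minors_nonnegD:
  assumes "all_minors_nonneg k I J M" "r \<le> k" "strict_mono_on {..<r} R" "strict_mono_on {..<r} C"
    "\<And>i. i < r \<Longrightarrow> R i \<in> I" "\<And>i. i < r \<Longrightarrow> C i \<in> J"
  shows "0 \<le> minor r M R C"
proof -
  have "R ` {..<r} \<subseteq> I" "C ` {..<r} \<subseteq> J" using assms(5,6) by auto
  then show ?thesis using assms(1-4) unfolding all_minors_nonneg_def by blast
qed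

lemma all_minors_nonneg_submatrix:
  assumes M: "all_minors_nonneg k I J M" and "k' \<le> k"
    and "strict_mono_on I' f" "strict_mono_on J' g" "f ` I' \<subseteq> I" "g ` J' \<subseteq> J"
  shows "all_minors_nonneg k' I' J' (\<lambda>i j. M (f i) (g j))"
  unfolding all_minors_nonneg_def
proof (intro allI impI)
  fix r R C
  assume r: "r \<le> k'" "strict_mono_on {..<r} R" "strict_mono_on {..<r} C"
    "R ` {..<r} \<subseteq> I'" "C ` {..<r} \<subseteq> J'"
  have "strict_mono_on {..<r} (f \<circ> R)"
    using r(2,4) assms(3) by (auto simp: strict_mono_on_def image_subset_iff)
  moreover have "strict_mono_on {..<r} (g \<circ> C)"
    using r(3,5) assms(4) by (auto simp: strict_mono_on_def image_subset_iff)
  ultimately have "0 \<le> minor r M (f \<circ> R) (g \<circ> C)"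
    using r assms(2,5,6) by (intro all_minors_nonnegD[OF M]) (auto simp: image_subset_iff)
  then show "0 \<le> minor r (\<lambda>i j. M (f i) (g j)) R C"
    by (simp add: minor_def)
qed

text \<open>
  Induction on the number of rows and columns. If the columns are linearly dependent, \<open>u\<close> can be
  moved along the kernel, keeping its sign pattern, until an entry vanishes and its column can
  be dropped. If the pattern \<open>b\<close> omits a block, rows can be dropped. Otherwise Cramer's rule for
  the first entry of \<open>u\<close> is violated.
\<close>

lemma no_flip:
  assumes "0 < r" "all_minors_nonneg r {..<r} {..<n} X"
    and "\<And>i j. i \<le> j \<Longrightarrow> j < n \<Longrightarrow> b i \<le> b j" "\<And>j. j < n \<Longrightarrow> b j < r"
    and "\<And>j. j < n \<Longrightarrow> 0 \<le> (-1) ^ b j * u j"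
    and "\<And>i. i < r \<Longrightarrow> (-1) ^ i * (\<Sum>j<n. X i j * u j) < 0"
  shows False
  using assms
proof (induction "n + r" arbitrary: n r X b u rule: less_induct)
  case less
  note pos = less.prems(1) and tp = less.prems(2) and mono = less.prems(3) and b = less.prems(4)
    and u = less.prems(5) and flip = less.prems(6)
  \<comment> \<open>With block 0 empty, blocks and rows are renumbered by one. Negating
    \<open>u\<close> compensates for the parity shift in both the sign pattern and the
    outputs.\<close>
  have drop_row_0: False if ne: "\<And>j. j < n \<Longrightarrow> b j \<noteq> 0" "1 < r"
  proof (rule less.hyps[where n = n and r = "r - 1" and X = "\<lambda>i. X (Suc i)" and b = "\<lambda>j. b j - 1"
        and u = "\<lambda>j. - u j"])
    show "all_minors_nonneg (r - 1) {..<r - 1} {..<n} (\<lambda>i. X (Suc i))"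
      using all_minors_nonneg_submatrix[OF tp, of "r - 1" "{..<r - 1}" Suc "{..<n}" "\<lambda>j. j"]
      by (auto simp: strict_mono_on_def image_subset_iff less_diff_conv)
    show "0 \<le> (-1) ^ (b j - 1) * - u j" if "j < n" for j
      using u[OF that] ne(1)[OF that] by (cases "b j") auto
    show "(-1) ^ i * (\<Sum>j<n. X (Suc i) j * - u j) < 0" if "i < r - 1" for i
      using flip[of "Suc i"] that by (simp add: sum_negf)
    show "b j - 1 < r - 1" if "j < n" for j
      using b[OF that] ne(1)[OF that] by linarith
    show "b i - 1 \<le> b j - 1" if "i \<le> j" "j < n" for i j
      using mono[OF that] by simp
  qed (use ne pos in auto)
  have drop_col: False
    if ker: "\<And>i. i < r \<Longrightarrow> (\<Sum>j<n. X i j * z j) = 0" "j0 < n" "z j0 \<noteq> 0" for z j0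
  proof -
    obtain t l where tl: "l < n" "u l + t * z l = 0" "\<And>j. j < n \<Longrightarrow> 0 \<le> (-1) ^ b j * (u j + t * z j)"
      by (rule move_to_boundary[of n "\<lambda>j. (-1) ^ b j" u j0 z]) (use u ker(2,3) in auto)
    obtain n' where n': "n = Suc n'" using tl(1) by (cases n) auto
    let ?g = "insert_index l"
    have g: "?g j < n" if "j < n'" for j
      using that by (auto simp: insert_index_def n')
    have g_mono: "?g i \<le> ?g j" if "i \<le> j" for i j
      using that by (auto simp: insert_index_def)
    show False
    proof (rule less.hyps[where n = n' and r = r and X = "\<lambda>i j. X i (?g j)" and b = "\<lambda>j. b (?g j)"
          and u = "\<lambda>j. u (?g j) + t * z (?g j)"])
      show "all_minors_nonneg r {..<r} {..<n'} (\<lambda>i j. X i (?g j))"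
        using all_minors_nonneg_submatrix[OF tp, of r "{..<r}" "\<lambda>i. i" "{..<n'}" ?g] g
          strict_mono_insert_index[of l] by (auto simp: strict_mono_on_def strict_mono_def)
      show "(-1) ^ i * (\<Sum>j<n'. X i (?g j) * (u (?g j) + t * z (?g j))) < 0" if "i < r" for i
      proof -
        have "(\<Sum>j<n'. X i (?g j) * (u (?g j) + t * z (?g j))) = (\<Sum>j<n. X i j * (u j + t * z j))"
          using sum_insert_index[of l n' "\<lambda>j. X i j * (u j + t * z j)"] tl(1,2) by (simp add: n')
        also have "\<dots> = (\<Sum>j<n. X i j * u j) + t * (\<Sum>j<n. X i j * z j)"
          by (simp add: algebra_simps sum.distrib sum_distrib_left)
        finally show ?thesis using flip[OF that] ker(1)[OF that] by simp
      qed
    qed (use pos mono b tl(3) g g_mono n' in auto)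
  qed
  consider "r < n" | "n = r" "minor n X (\<lambda>i. i) (\<lambda>j. j) = 0" | "n = r" "minor n X (\<lambda>i. i) (\<lambda>j. j) \<noteq> 0"
    | "n < r" by linarith
  then show False
  proof cases
    case 1
    \<comment> \<open>With fewer rows than columns, zero rows complete \<open>X\<close> to a
      singular square matrix, whose kernel vector also kills the rows of \<open>X\<close>.\<close>
    let ?X = "\<lambda>i j. if i < r then X i j else 0"
    have "minor n ?X (\<lambda>i. i) (\<lambda>j. j) = 0"
      by (rule minor_zero_row[of r]) (use 1 in auto)
    then obtain z j where "j < n" "z j \<noteq> 0" and z: "\<And>i. i < n \<Longrightarrow> (\<Sum>j<n. ?X i j * z j) = 0"
      by (rule minor_zero_kernel) blast
    moreover have "(\<Sum>j<n. X i j * z j) = 0" if "i < r" for i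
      using z[of i] that 1 by simp
    ultimately show False using drop_col by blast
  next
    case 2
    obtain z j where "j < n" "z j \<noteq> 0" "\<And>i. i < n \<Longrightarrow> (\<Sum>j<n. X i j * z j) = 0"
      using minor_zero_kernel[OF 2(2)] by blast
    then show False using drop_col 2(1) by blast
  next
    case 3
    have det: "0 < minor r X (\<lambda>i. i) (\<lambda>j. j)"
    proof -
      have "0 \<le> minor r X (\<lambda>i. i) (\<lambda>j. j)"
        by (rule all_minors_nonnegD[OF tp]) (use 3 in \<open>auto simp: strict_mono_on_def\<close>)
      then show ?thesis using 3 by simp
    qed
    show False
    proof (cases "b 0 = 0")
      case False
      then have "b j \<noteq> 0" if "j < n" for j
        using mono[of 0 j] that by simp
      moreover have "1 < r" using b[of 0] False pos 3(1) by auto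
      ultimately show False by (rule drop_row_0)
    next
      case True
      obtain m where m: "r = Suc m" using pos by (cases r) auto
      let ?c = "\<lambda>i. minor m X (\<lambda>a. insert_index i a) Suc"
      have exp: "(\<Sum>i<Suc m. (-1) ^ i * X i l * ?c i)
          = (if l = 0 then minor r X (\<lambda>i. i) (\<lambda>j. j) else 0)" if "l < Suc m" for l
      proof -
        have "insert_index 0 = Suc" by (auto simp: insert_index_def)
        then show ?thesis
          using cofactor_sum_col[of 0 m l X "\<lambda>i. i" "\<lambda>j. j"] that by (simp add: m o_def)
      qed
      have c: "0 \<le> ?c i" if "i < r" for i
        by (rule all_minors_nonnegD[OF tp]) (use 3 that in \<open>auto simp: m strict_mono_on_def insert_index_def\<close>)
      \<comment> \<open>Cramer's rule for \<open>u 0\<close>. Every summand on the left is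
        nonpositive by the flip, while the right side is nonnegative because entry 0 lies in block
        0. So all summands vanish, hence all cofactors of column 0, contradicting the positive
        determinant.\<close>
      have "(\<Sum>i<Suc m. (-1) ^ i * (\<Sum>j<n. X i j * u j) * ?c i) =
          (\<Sum>j<n. u j * (\<Sum>i<Suc m. (-1) ^ i * X i j * ?c i))"
        unfolding sum_distrib_left sum_distrib_right
        by (subst sum.swap) (simp add: mult_ac)
      also have "\<dots> = (\<Sum>j<n. u j * (if j = 0 then minor r X (\<lambda>i. i) (\<lambda>j. j) else 0))"
        using 3(1) by (intro sum.cong refl arg_cong2[where f = "(*)"] exp) (auto simp: m)
      also have "\<dots> = u 0 * minor r X (\<lambda>i. i) (\<lambda>j. j)"
        using 3(1) pos by (simp add: if_distrib[of "\<lambda>x. _ * x"] cong: if_cong)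
      finally have cramer: "(\<Sum>i<Suc m. ((-1) ^ i * (\<Sum>j<n. X i j * u j)) * ?c i) =
          u 0 * minor r X (\<lambda>i. i) (\<lambda>j. j)" .
      have "0 \<le> u 0" using u[of 0] True 3(1) pos by simp
      then have nonneg: "0 \<le> (\<Sum>i<Suc m. ((-1) ^ i * (\<Sum>j<n. X i j * u j)) * ?c i)"
        unfolding cramer using det by simp
      have le: "((-1) ^ i * (\<Sum>j<n. X i j * u j)) * ?c i \<le> 0" if "i < Suc m" for i
        by (rule mult_nonpos_nonneg) (use flip[of i] c[of i] that in \<open>auto simp: m\<close>)
      have "(\<Sum>i<Suc m. - (((-1) ^ i * (\<Sum>j<n. X i j * u j)) * ?c i)) = 0"
        using nonneg sum_nonpos[of "{..<Suc m}" "\<lambda>i. ((-1) ^ i * (\<Sum>j<n. X i j * u j)) * ?c i"] le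
        unfolding sum_negf by fastforce
      then have "- (((-1) ^ i * (\<Sum>j<n. X i j * u j)) * ?c i) = 0" if "i < Suc m" for i
        by (subst (asm) sum_nonneg_eq_0_iff) (use le that in auto)
      then have "?c i = 0" if "i < Suc m" for i
        using that flip[of i] by (fastforce simp: m)
      then show False using exp[of 0] det by simp
    qed
  next
    case 4
    \<comment> \<open>Fewer columns than rows: by counting, some block \<open>q\<close> contains no
      column.\<close>
    have "card (b ` {..<n}) \<le> n"
      using card_image_le[of "{..<n}" b] by simp
    then have "\<not> {..<r} \<subseteq> b ` {..<n}"
      using card_mono[of "b ` {..<n}" "{..<r}"] 4 by auto
    then obtain q where q: "q < r" "\<And>j. j < n \<Longrightarrow> b j \<noteq> q" by auto
    have lt: "b j < q \<or> q < b j" if "j < n" for j using q(2)[OF that] by linarith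
    show False
    proof (cases "r = 1")
      case True
      then have "n = 0" using b q by fastforce
      then show False using flip[of 0] pos by simp
    next
      case False
      consider "q = 0" | "q = r - 1" "q \<noteq> 0" | "0 < q" "q < r - 1" using q(1) by linarith
      then show False
      proof cases
        case 1
        then show False using drop_row_0 q(2) False pos by fastforce
      next
        case 2
        have bq: "b j < r - 1" if "j < n" for j
          using b[OF that] q(2)[OF that] 2 by linarith
        show False
        proof (rule less.hyps[where n = n and r = "r - 1" and X = X and b = b and u = u])
          show "all_minors_nonneg (r - 1) {..<r - 1} {..<n} X"
            using all_minors_nonneg_submatrix[OF tp, of "r - 1" "{..<r - 1}" "\<lambda>i. i" "{..<n}" "\<lambda>j. j"]
            by (auto simp: strict_mono_on_def)
        qed (use 2 q mono u flip pos False bq in auto)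
      next
        case 3
        \<comment> \<open>Blocks \<open>q - 1\<close> and \<open>q + 1\<close> carry the same sign
          and can be merged. Lowering the block numbers above \<open>q\<close> by 2 keeps their
          parity, and the last two rows are discarded.\<close>
        show False
        proof (rule less.hyps[where n = n and r = "r - 2" and X = X
              and b = "\<lambda>j. if b j < q then b j else b j - 2" and u = u])
          show "all_minors_nonneg (r - 2) {..<r - 2} {..<n} X"
            using all_minors_nonneg_submatrix[OF tp, of "r - 2" "{..<r - 2}" "\<lambda>i. i" "{..<n}" "\<lambda>j. j"]
            by (auto simp: strict_mono_on_def)
          show "0 \<le> (-1) ^ (if b j < q then b j else b j - 2) * u j" if "j < n" for j
          proof (cases "b j < q")
            case False
            then have "b j = Suc (Suc (b j - 2))" using lt[OF that] 3 by linarith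
            then have "(-1 :: real) ^ b j = (-1) ^ (b j - 2)" by (metis power_minus1_even power_add
              add_2_eq_Suc mult_1 power2_minus power_one)
            then show ?thesis using u[OF that] False by simp
          qed (use u[OF that] in auto)
          show "(if b i < q then b i else b i - 2) \<le> (if b j < q then b j else b j - 2)"
            if "i \<le> j" "j < n" for i j
            using mono[OF that] lt[of i] lt[of j] that by auto
          show "(if b j < q then b j else b j - 2) < r - 2" if "j < n" for j
            using b[OF that] lt[OF that] 3 by auto
        qed (use 3 flip in auto)
      qed
    qed
  qed
qed

subsection \<open>Sign variation\<close>

text \<open>A running block number: finite at every index even if the variation is infinite, and the
  source of the pattern \<open>b\<close> in \<open>no_flip\<close>.\<close>

definition changes_upto :: "(nat \<Rightarrow> real) \<Rightarrow> nat \<Rightarrow> nat" where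
  "changes_upto u i = card {p \<in> sign_changes u. snd p \<le> i}"

lemma finite_changes_upto: "finite {p \<in> sign_changes u. snd p \<le> i}"
  by (rule finite_subset[of _ "{..i} \<times> {..i}"]) (auto simp: sign_changes_def)

lemma changes_upto_mono: "i \<le> j \<Longrightarrow> changes_upto u i \<le> changes_upto u j"
  unfolding changes_upto_def by (rule card_mono[OF finite_changes_upto]) auto

lemma sign_changes_unique:
  assumes "(a, b) \<in> sign_changes u" "(a', b) \<in> sign_changes u"
  shows "a = a'"
proof -
  have "u a \<noteq> 0" "u a' \<noteq> 0" using assms by (auto simp: sign_changes_def)
  then have "\<not> a < a'" "\<not> a' < a" using assms by (auto simp: sign_changes_def)
  then show ?thesis by simp
qed

lemma changes_upto_eq_0:
  assumes "\<And>a. a < i \<Longrightarrow> u a = 0"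
  shows "changes_upto u i = 0"
proof -
  have "{p \<in> sign_changes u. snd p \<le> i} = {}"
    using assms by (force simp: sign_changes_def)
  then show ?thesis unfolding changes_upto_def by (simp only: card.empty)
qed

text \<open>A sign change is determined by its right end, so the count rises by at most one per
  index and skips no value.\<close>

lemma changes_upto_Suc:
  assumes "changes_upto u (Suc i) \<noteq> changes_upto u i"
  shows "changes_upto u (Suc i) = Suc (changes_upto u i)" "u (Suc i) \<noteq> 0"
proof -
  let ?S = "\<lambda>i. {p \<in> sign_changes u. snd p \<le> i}"
  have "?S (Suc i) \<noteq> ?S i" using assms by (auto simp: changes_upto_def)
  then obtain a where a: "(a, Suc i) \<in> sign_changes u" by (auto simp: le_Suc_eq)
  have new: "(x, Suc i) \<in> sign_changes u \<longleftrightarrow> x = a" for x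
    using sign_changes_unique a by blast
  have "?S (Suc i) = insert (a, Suc i) (?S i)"
  proof (rule Set.set_eqI)
    fix p
    show "p \<in> ?S (Suc i) \<longleftrightarrow> p \<in> insert (a, Suc i) (?S i)"
      by (cases p, cases "snd p = Suc i") (simp_all add: new le_Suc_eq)
  qed
  then show "changes_upto u (Suc i) = Suc (changes_upto u i)"
    unfolding changes_upto_def using finite_changes_upto[of u i] by (simp add: card_insert_if)
  show "u (Suc i) \<noteq> 0" using a by (auto simp: sign_changes_def)
qed

text \<open>Let \<open>a\<close> be the last nonzero index before \<open>i\<close>. The only change
  that can be added between \<open>a\<close> and \<open>i\<close> is \<open>(a, i)\<close>, and it
  is added exactly when the two signs differ.\<close>

lemma sgn_changes_upto:
  assumes "u i \<noteq> 0"
  shows "sgn (u i) = first_sign u * (-1) ^ changes_upto u i"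
  using assms
proof (induction i rule: less_induct)
  case (less i)
  show ?case
  proof (cases "\<exists>a<i. u a \<noteq> 0")
    case False
    then have "(LEAST i. u i \<noteq> 0) = i"
      using less.prems by (intro Least_equality) (auto simp: not_less[symmetric])
    then show ?thesis
      using changes_upto_eq_0[of i u] False by (simp add: first_sign_def)
  next
    case True
    let ?A = "{a. a < i \<and> u a \<noteq> 0}"
    define a where "a = Max ?A"
    have "finite ?A" "?A \<noteq> {}" using True by auto
    then have a: "a < i" "u a \<noteq> 0" and max: "\<And>x. x < i \<Longrightarrow> u x \<noteq> 0 \<Longrightarrow> x \<le> a"
      using Max_in[of ?A] Max_ge[of ?A] by (auto simp: a_def)
    let ?S = "\<lambda>i. {p \<in> sign_changes u. snd p \<le> i}"
    have new: "(x, y) \<in> ?S i - ?S a \<longleftrightarrow> (x, y) = (a, i) \<and> u a * u i < 0" for x y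
    proof
      assume xy: "(x, y) \<in> ?S i - ?S a"
      then have sc: "x < y" "u x * u y < 0" "\<And>l. x < l \<Longrightarrow> l < y \<Longrightarrow> u l = 0"
        and y: "y \<le> i" "a < y" by (auto simp: sign_changes_def)
      have nz: "u x \<noteq> 0" "u y \<noteq> 0" using sc(2) by auto
      have "y = i" using max[of y] nz y by force
      moreover have "x = a"
        using max[of x] nz sc(1) sc(3)[of a] a y \<open>y = i\<close> by force
      ultimately show "(x, y) = (a, i) \<and> u a * u i < 0" using sc(2) by simp
    next
      assume "(x, y) = (a, i) \<and> u a * u i < 0"
      then show "(x, y) \<in> ?S i - ?S a"
        using a max by (force simp: sign_changes_def)
    qed
    have "?S a \<subseteq> ?S i" using a by auto
    then have "changes_upto u i = changes_upto u a + card (?S i - ?S a)"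
      unfolding changes_upto_def
      by (simp add: card_Diff_subset finite_changes_upto card_mono)
    also have "?S i - ?S a = (if u a * u i < 0 then {(a, i)} else {})"
    proof (rule Set.set_eqI)
      fix p
      show "p \<in> ?S i - ?S a \<longleftrightarrow> p \<in> (if u a * u i < 0 then {(a, i)} else {})"
        using new[of "fst p" "snd p"] unfolding prod.collapse by auto
    qed
    finally have *: "changes_upto u i = changes_upto u a + (if u a * u i < 0 then 1 else 0)"
      by simp
    have "sgn (u i) = sgn (u a) * (-1) ^ (if u a * u i < 0 then 1 else 0)"
      using a(2) less.prems by (auto simp: sgn_if mult_less_0_iff)
    then show ?thesis
      using less.IH[OF a] unfolding * by (simp add: power_add)
  qed
qed

text \<open>Turns bounds on the possibly infinite variation into finite counts: any \<open>m\<close>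
  changes end below a common index.\<close>

lemma enat_le_variation_iff: "enat m \<le> variation u \<longleftrightarrow> (\<exists>i. m \<le> changes_upto u i)"
proof
  assume le: "enat m \<le> variation u"
  obtain T where T: "T \<subseteq> sign_changes u" "finite T" "card T = m"
  proof (cases "finite (sign_changes u)")
    case True
    then show ?thesis
      using that obtain_subset_with_card_n[of m "sign_changes u"] le finite_subset
      by (metis variation_def enat_ord_simps(1))
  next
    case False
    then show ?thesis
      using that infinite_arbitrarily_large[of "sign_changes u" m] by blast
  qed
  define i where "i = Max (insert 0 (snd ` T))"
  have "T \<subseteq> {p \<in> sign_changes u. snd p \<le> i}"
    using T by (auto simp: i_def intro!: Max_ge rev_image_eqI)
  then have "m \<le> changes_upto u i"
    unfolding changes_upto_def using T(3) card_mono[OF finite_changes_upto] by blast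
  then show "\<exists>i. m \<le> changes_upto u i" ..
next
  assume "\<exists>i. m \<le> changes_upto u i"
  then obtain i where i: "m \<le> changes_upto u i" ..
  have "changes_upto u i \<le> card (sign_changes u)" if "finite (sign_changes u)"
    unfolding changes_upto_def using that by (intro card_mono) auto
  then show "enat m \<le> variation u"
    using i by (auto simp: variation_def)
qed

lemma alternating_subsequence:
  assumes "enat m \<le> variation u" "u i0 \<noteq> 0"
  obtains R where "strict_mono_on {..<Suc m} R"
    "\<And>l. l < Suc m \<Longrightarrow> 0 < first_sign u * (-1) ^ l * u (R l)"
proof -
  obtain k where k: "m \<le> changes_upto u k" using assms(1) enat_le_variation_iff by blast
  have "\<exists>i. u i \<noteq> 0 \<and> changes_upto u i = l" if l: "l \<le> m" for l
  proof (cases l)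
    case 0
    let ?i = "LEAST i. u i \<noteq> 0"
    have "u ?i \<noteq> 0" using assms(2) by (rule LeastI)
    moreover have "changes_upto u ?i = 0"
      by (rule changes_upto_eq_0) (use not_less_Least in blast)
    ultimately show ?thesis using 0 by blast
  next
    case (Suc l')
    \<comment> \<open>Where the count first reaches \<open>l\<close> it has just risen by one, so it
      equals \<open>l\<close> there and the entry is nonzero.\<close>
    define i where "i = (LEAST i. l \<le> changes_upto u i)"
    have i: "l \<le> changes_upto u i"
      unfolding i_def by (rule LeastI[of _ k]) (use k l in simp)
    have below: "changes_upto u j < l" if "j < i" for j
      using not_less_Least[of j "\<lambda>i. l \<le> changes_upto u i"] that by (simp add: i_def)
    have "i \<noteq> 0"
      using i Suc changes_upto_eq_0[of 0 u] by (metis le_zero_eq not_less_zero old.nat.distinct(1))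
    then obtain j where j: "i = Suc j" by (cases i) auto
    then have ne: "changes_upto u (Suc j) \<noteq> changes_upto u j"
      using i below[of j] by auto
    have "changes_upto u i = l"
      using changes_upto_Suc(1)[OF ne] below[of j] i j by auto
    then show ?thesis using changes_upto_Suc(2)[OF ne] j by blast
  qed
  then obtain R where R: "\<And>l. l \<le> m \<Longrightarrow> u (R l) \<noteq> 0 \<and> changes_upto u (R l) = l"
    by metis
  show thesis
  proof (rule that)
    show "strict_mono_on {..<Suc m} R"
    proof (rule strict_mono_onI)
      fix a b assume "a \<in> {..<Suc m}" "b \<in> {..<Suc m}" "a < b"
      then show "R a < R b"
        using R[of a] R[of b] changes_upto_mono[of "R b" "R a" u] by force
    qed
    fix l assume l: "l < Suc m"
    have fs: "first_sign u \<noteq> 0"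
      using sgn_changes_upto[of u i0] assms(2) by (auto simp: sgn_if split: if_splits)
    have "u (R l) = \<bar>u (R l)\<bar> * sgn (u (R l))" by (simp only: abs_mult_sgn)
    also have "\<dots> = \<bar>u (R l)\<bar> * (first_sign u * (-1) ^ l)"
      using sgn_changes_upto[of u "R l"] R[of l] l by simp
    finally have "first_sign u * (-1) ^ l * u (R l) = \<bar>u (R l)\<bar> * (first_sign u * (-1) ^ l)\<^sup>2"
      by (metis mult.commute mult.left_commute power2_eq_square)
    then show "0 < first_sign u * (-1) ^ l * u (R l)"
      using R[of l] l fs by (simp add: power_mult_distrib)
  qed
qed

text \<open>The offset \<open>d\<close> retains changes that occurred before \<open>R 0\<close>.
  With \<open>d = 1\<close> it supplies the surplus change when the leading sign of \<open>u\<close>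
  differs from the sign at \<open>R 0\<close>.\<close>

lemma changes_upto_alternating:
  assumes R: "strict_mono_on {..<Suc m} R"
    and alt: "\<And>l. l < Suc m \<Longrightarrow> 0 < s * (-1) ^ l * u (R l)"
    and d: "d \<le> changes_upto u (R 0)" and "l \<le> m"
  shows "d + l \<le> changes_upto u (R l)"
  using \<open>l \<le> m\<close>
proof (induction l)
  case 0
  then show ?case using d by simp
next
  case (Suc l)
  have IH: "d + l \<le> changes_upto u (R l)" using Suc by simp
  have "changes_upto u (R (Suc l)) \<noteq> changes_upto u (R l)"
  proof
    assume eq: "changes_upto u (R (Suc l)) = changes_upto u (R l)"
    have pos: "0 < s * (-1) ^ l * u (R l)" "0 < s * (-1) ^ Suc l * u (R (Suc l))"
      using alt[of l] alt[of "Suc l"] Suc.prems by auto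
    then have "u (R l) \<noteq> 0" "u (R (Suc l)) \<noteq> 0" by auto
    then have "sgn (u (R (Suc l))) = sgn (u (R l))"
      using eq by (simp add: sgn_changes_upto)
    moreover have "sgn (s * (-1) ^ l * u (R l)) = 1" "sgn (s * (-1) ^ Suc l * u (R (Suc l))) = 1"
      using pos by (simp_all only: sgn_pos)
    ultimately show False
      by (simp add: sgn_mult)
  qed
  moreover have "R l < R (Suc l)"
    using R Suc.prems by (auto simp: strict_mono_on_def)
  ultimately show ?case
    using IH changes_upto_mono[of "R l" "R (Suc l)" u] by simp
qed

lemma variation_alternating:
  assumes "strict_mono_on {..<Suc m} R" "\<And>l. l < Suc m \<Longrightarrow> 0 < s * (-1) ^ l * u (R l)"
  shows "enat m \<le> variation u"
  using changes_upto_alternating[where d = 0 and l = m, OF assms] enat_le_variation_iff by auto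

section \<open>Nonnegative minors and variation diminution\<close>

lemma first_sign_cases:
  assumes "u i \<noteq> 0"
  shows "first_sign u = 1 \<or> first_sign u = -1"
proof -
  have "u (LEAST i. u i \<noteq> 0) \<noteq> 0" using assms by (rule LeastI)
  then show ?thesis by (auto simp: first_sign_def sgn_if)
qed

lemma first_sign_changes_upto: "0 \<le> first_sign u * (-1) ^ changes_upto u i * u i"
proof (cases "u i = 0")
  case False
  then have "first_sign u * (-1) ^ changes_upto u i * u i = sgn (u i) * u i"
    by (simp add: sgn_changes_upto)
  also have "0 \<le> sgn (u i) * u i" by (simp add: sgn_if)
  finally show ?thesis .
qed simp

lemma minors_nonneg_imp_variation_diminishing:
  assumes M: "all_minors_nonneg (Suc m) UNIV UNIV M"
    and w: "\<And>i. (\<lambda>j. M i j * u j) sums w i"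
    and u: "variation u \<le> enat m"
  shows "variation w \<le> variation u \<and>
    (variation w = variation u \<longrightarrow> (\<exists>i. u i \<noteq> 0) \<longrightarrow> (\<exists>i. w i \<noteq> 0) \<longrightarrow> first_sign u = first_sign w)"
proof (cases "\<exists>i. u i \<noteq> 0")
  case False
  have "w i = 0" for i
    using w[of i] False sums_unique2[OF _ sums_zero] by auto
  then have "sign_changes w = {}" by (auto simp: sign_changes_def)
  then show ?thesis using False by (simp add: variation_def zero_enat_def[symmetric])
next
  case True
  then obtain i0 where i0: "u i0 \<noteq> 0" by blast
  note fu = first_sign_cases[of u, OF i0]
  obtain m' where m': "variation u = enat m'" "m' \<le> m"
    using u by (cases "variation u") auto
  have bound: "changes_upto u j < Suc m'" for j
    using enat_le_variation_iff[of "changes_upto u j" u] m'(1) by auto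
  \<comment> \<open>Both OVD clauses reduce to excluding a flip: \<open>m' + 1\<close> strictly
    alternating outputs whose leading sign is opposite to that of \<open>u\<close>.\<close>
  have no: False if R: "strict_mono_on {..<Suc m'} R"
    and flip: "\<And>l. l < Suc m' \<Longrightarrow> first_sign u * (-1) ^ l * w (R l) < 0" for R
  proof -
    have "\<forall>\<^sub>F n in sequentially. first_sign u * (-1) ^ l * (\<Sum>j<n. M (R l) j * u j) < 0"
      if "l < Suc m'" for l
    proof (rule order_tendstoD(2)[OF _ flip[OF that]])
      show "(\<lambda>n. first_sign u * (-1) ^ l * (\<Sum>j<n. M (R l) j * u j)) \<longlonglongrightarrow>
          first_sign u * (-1) ^ l * w (R l)"
        by (intro tendsto_mult_left w[unfolded sums_def])
    qed
    then have "\<forall>\<^sub>F n in sequentially. \<forall>l\<in>{..<Suc m'}. first_sign u * (-1) ^ l * (\<Sum>j<n. M (R l) j * u j) < 0"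
      by (intro eventually_ball_finite) auto
    then obtain n where n: "\<And>l. l < Suc m' \<Longrightarrow> first_sign u * (-1) ^ l * (\<Sum>j<n. M (R l) j * u j) < 0"
      by (auto simp: eventually_sequentially)
    show False
    proof (rule no_flip[of "Suc m'" n "\<lambda>i j. M (R i) j" "changes_upto u" "\<lambda>j. first_sign u * u j"])
      show "all_minors_nonneg (Suc m') {..<Suc m'} {..<n} (\<lambda>i j. M (R i) j)"
        using all_minors_nonneg_submatrix[OF M, of "Suc m'" "{..<Suc m'}" R "{..<n}" "\<lambda>j. j"] m'(2) R
        by (auto simp: strict_mono_on_def)
      show "0 \<le> (-1) ^ changes_upto u j * (first_sign u * u j)" for j
        using first_sign_changes_upto[of u j] by (simp add: mult_ac)
      show "(-1) ^ i * (\<Sum>j<n. M (R i) j * (first_sign u * u j)) < 0" if "i < Suc m'" for i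
      proof -
        have "(\<Sum>j<n. M (R i) j * (first_sign u * u j)) = first_sign u * (\<Sum>j<n. M (R i) j * u j)"
          by (simp add: sum_distrib_left mult_ac)
        then show ?thesis using n[OF that] by (simp add: mult_ac)
      qed
    qed (use changes_upto_mono bound in auto)
  qed
  have le: "variation w \<le> enat m'"
  proof (rule ccontr)
    assume "\<not> variation w \<le> enat m'"
    then have ge: "enat (Suc m') \<le> variation w"
      by (simp add: Suc_ile_eq)
    then obtain k where "Suc m' \<le> changes_upto w k" using enat_le_variation_iff by blast
    then obtain i1 where i1: "w i1 \<noteq> 0"
      using changes_upto_eq_0[of k w] by fastforce
    obtain R where R: "strict_mono_on {..<Suc (Suc m')} R"
      and alt: "\<And>l. l < Suc (Suc m') \<Longrightarrow> 0 < first_sign w * (-1) ^ l * w (R l)"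
      using alternating_subsequence[OF ge i1] by blast
    \<comment> \<open>Among \<open>m' + 2\<close> alternating outputs a flip remains after dropping
      the first one if its sign agrees with \<open>u\<close>, and the last one otherwise.\<close>
    consider "first_sign w = first_sign u" | "first_sign w = - first_sign u"
      using fu first_sign_cases[of w, OF i1] by auto
    then show False
    proof cases
      case 1
      show False
      proof (rule no[of "R \<circ> Suc"])
        show "strict_mono_on {..<Suc m'} (R \<circ> Suc)" using R by (auto simp: strict_mono_on_def)
        show "first_sign u * (-1) ^ l * w ((R \<circ> Suc) l) < 0" if "l < Suc m'" for l
          using alt[of "Suc l"] that 1 by simp
      qed
    next
      case 2
      show False
      proof (rule no[of R])
        show "strict_mono_on {..<Suc m'} R" using R by (auto simp: strict_mono_on_def)
        show "first_sign u * (-1) ^ l * w (R l) < 0" if "l < Suc m'" for l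
          using alt[of l] that 2 by simp
      qed
    qed
  qed
  have "first_sign u = first_sign w" if eq: "variation w = variation u" and "w i1 \<noteq> 0" for i1
  proof (rule ccontr)
    assume "first_sign u \<noteq> first_sign w"
    then have fw: "first_sign w = - first_sign u"
      using fu first_sign_cases[of w, OF that(2)] by auto
    have "enat m' \<le> variation w" using eq m'(1) by simp
    from alternating_subsequence[OF this that(2)]
    obtain R where "strict_mono_on {..<Suc m'} R"
      "\<And>l. l < Suc m' \<Longrightarrow> 0 < first_sign w * (-1) ^ l * w (R l)" by blast
    then show False by (intro no[of R]) (auto simp: fw)
  qed
  then show ?thesis using le m'(1) by auto
qed

text \<open>
  For a negative minor of least order, the input that alternates with the column sums of its
  cofactor matrix is mapped to an output alternating with the opposite sign.
\<close>

lemma ovd_imp_minor_nonneg: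
  assumes ovd: "ovd m D \<sigma> \<tau> X"
    and sums: "\<And>u i. u \<in> D \<Longrightarrow> (\<lambda>j. M i j * \<sigma> u j) sums \<tau> (X u) i"
    and D: "\<And>v. finite {j. v j \<noteq> 0} \<Longrightarrow> {j. v j \<noteq> 0} \<subseteq> J \<Longrightarrow> v \<in> \<sigma> ` D"
    and "r \<le> Suc m" "strict_mono_on {..<r} R" "strict_mono_on {..<r} C" "C ` {..<r} \<subseteq> J"
  shows "0 \<le> minor r M R C"
  using assms(4-)
proof (induction r arbitrary: R C)
  case 0
  then show ?case by simp
next
  case (Suc r)
  note R = Suc.prems(2) and C = Suc.prems(3)
  show ?case
  proof (rule ccontr)
    assume "\<not> 0 \<le> minor (Suc r) M R C"
    then have neg: "minor (Suc r) M R C < 0" by simp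
    let ?c = "\<lambda>i j. minor r M (R \<circ> insert_index i) (C \<circ> insert_index j)"
    have c: "0 \<le> ?c i j" for i j
    proof (rule Suc.IH)
      show "strict_mono_on {..<r} (R \<circ> insert_index i)" "strict_mono_on {..<r} (C \<circ> insert_index j)"
        using R C by (auto simp: strict_mono_on_def insert_index_def)
      show "(C \<circ> insert_index j) ` {..<r} \<subseteq> J"
        using Suc.prems(4) by (auto simp: insert_index_def)
    qed (use Suc.prems in simp)
    define S where "S j = (\<Sum>i<Suc r. ?c i j)" for j
    \<comment> \<open>A vanishing column sum of nonnegative cofactor minors would force all of them
      to vanish, and the minor with them.\<close>
    have S: "0 < S j" if "j < Suc r" for j
    proof (rule ccontr)
      assume "\<not> 0 < S j"
      moreover have "0 \<le> S j" unfolding S_def by (rule sum_nonneg) (use c in auto)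
      ultimately have "(\<Sum>i<Suc r. ?c i j) = 0" by (simp add: S_def)
      then have "?c i j = 0" if "i < Suc r" for i
        by (subst (asm) sum_nonneg_eq_0_iff) (use c that in auto)
      then have "minor (Suc r) M R C = 0"
        unfolding minor_expand_col[OF that] by (intro sum.neutral) auto
      then show False using neg by simp
    qed
    have inj: "inj_on C {..<Suc r}" using C by (rule strict_mono_on_imp_inj_on)
    \<comment> \<open>Places \<open>(-1) ^ j * S j\<close> at position \<open>C j\<close> without
      inverting \<open>C\<close>.\<close>
    define v where "v x = (\<Sum>j<Suc r. if C j = x then (-1) ^ j * S j else 0)" for x
    have vC: "v (C j) = (-1) ^ j * S j" if "j < Suc r" for j
    proof -
      have "v (C j) = (\<Sum>i<Suc r. if i = j then (-1) ^ j * S j else 0)"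
        unfolding v_def using inj that by (intro sum.cong) (auto dest: inj_onD)
      then show ?thesis using that by simp
    qed
    have v0: "v x = 0" if "x \<notin> C ` {..<Suc r}" for x
      unfolding v_def by (rule sum.neutral) (use that in auto)
    have supp: "{j. v j \<noteq> 0} \<subseteq> C ` {..<Suc r}" using v0 by blast
    then obtain u where u: "u \<in> D" "\<sigma> u = v"
      using D[of v] Suc.prems(4) finite_subset[OF supp] by blast
    let ?w = "\<tau> (X u)"
    have sgn: "(-1) ^ a * ((-1) ^ (a + j) * x * y) = x * ((-1) ^ j * y)" for a j :: nat and x y :: real
      by (cases "even a") (simp_all add: power_add)
    \<comment> \<open>Summing over the deleted row \<open>a\<close> last turns the output into
      cofactor expansions of row \<open>R i\<close>; those with \<open>a\<close> different from
      \<open>i\<close> vanish.\<close>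
    have wR: "?w (R i) = (-1) ^ i * minor (Suc r) M R C" if "i < Suc r" for i
    proof -
      have "(\<lambda>j. M (R i) j * v j) sums (\<Sum>j\<in>C ` {..<Suc r}. M (R i) j * v j)"
        by (rule sums_finite) (use v0 in auto)
      then have "?w (R i) = (\<Sum>j\<in>C ` {..<Suc r}. M (R i) j * v j)"
        using sums[OF u(1), of "R i"] sums_unique2 unfolding u(2) by blast
      also have "\<dots> = (\<Sum>j<Suc r. M (R i) (C j) * ((-1) ^ j * S j))"
        by (subst sum.reindex[OF inj]) (simp add: vC)
      also have "\<dots> = (\<Sum>a<Suc r. (-1) ^ a * (\<Sum>j<Suc r. (-1) ^ (a + j) * M (R i) (C j) * ?c a j))"
        unfolding S_def sum_distrib_left
        by (subst sum.swap) (simp only: sgn)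
      also have "\<dots> = (\<Sum>a<Suc r. (-1) ^ a * (if i = a then minor (Suc r) M R C else 0))"
        using that by (intro sum.cong refl arg_cong2[where f = "(*)"] cofactor_sum) auto
      finally show ?thesis using that by (simp add: if_distrib[of "\<lambda>x. _ * x"] cong: if_cong)
    qed
    have v_alt: "0 < 1 * (-1) ^ l * v (C l)" if "l < Suc r" for l
      using vC[OF that] S[OF that] by (simp add: power_mult_distrib[symmetric] flip: mult.assoc)
    have "enat r \<le> variation v"
      by (rule variation_alternating[OF C v_alt])
    \<comment> \<open>Another change would need \<open>r + 2\<close> nonzero entries, but the
      support of \<open>v\<close> has only \<open>r + 1\<close> points.\<close>
    moreover have "\<not> enat (Suc r) \<le> variation v"
    proof
      assume "enat (Suc r) \<le> variation v"
      moreover have "v (C 0) \<noteq> 0" using v_alt[of 0] by simp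
      ultimately obtain Q where Q: "strict_mono_on {..<Suc (Suc r)} Q"
        "\<And>l. l < Suc (Suc r) \<Longrightarrow> 0 < first_sign v * (-1) ^ l * v (Q l)"
        using alternating_subsequence[of "Suc r" v "C 0"] by blast
      then have "v (Q l) \<noteq> 0" if "l < Suc (Suc r)" for l using that by fastforce
      then have "Q ` {..<Suc (Suc r)} \<subseteq> C ` {..<Suc r}" using v0 by blast
      then have "card (Q ` {..<Suc (Suc r)}) \<le> card (C ` {..<Suc r})"
        by (intro card_mono) auto
      then show False
        using inj strict_mono_on_imp_inj_on[OF Q(1)] by (simp add: card_image)
    qed
    ultimately have var_v: "variation v = enat r"
      by (cases "variation v") auto
    have "(LEAST x. v x \<noteq> 0) = C 0"
    proof (rule Least_equality)
      show "v (C 0) \<noteq> 0" using v_alt[of 0] by simp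
      fix y assume "v y \<noteq> 0"
      then obtain j where "j < Suc r" "y = C j" using v0 by blast
      then show "C 0 \<le> y"
        using C by (cases "j = 0") (auto simp: strict_mono_on_def order_less_imp_le)
    qed
    then have fs_v: "first_sign v = 1"
      using v_alt[of 0] by (simp add: first_sign_def)
    have w_alt: "0 < -1 * (-1) ^ l * ?w (R l)" if "l < Suc r" for l
      using wR[OF that] neg by (simp add: power_mult_distrib[symmetric] flip: mult.assoc)
    have "enat r \<le> variation ?w"
      by (rule variation_alternating[OF R w_alt])
    moreover have "variation v \<le> enat m" using Suc.prems(1) var_v by simp
    ultimately have eq: "variation ?w = variation v" and
      fs: "(\<exists>i. v i \<noteq> 0) \<Longrightarrow> (\<exists>i. ?w i \<noteq> 0) \<Longrightarrow> first_sign v = first_sign ?w"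
      using ovd u var_v unfolding ovd_def by (auto intro: antisym)
    \<comment> \<open>OVD makes the first nonzero output positive, yet the output at
      \<open>R 0\<close> is negative. So a change ends by \<open>R 0\<close>, in addition to the
      \<open>r\<close> changes along \<open>R\<close>, which exceeds the variation of the
      input.\<close>
    have "?w (R 0) < 0" using w_alt[of 0] by simp
    then have "first_sign ?w = 1"
      using fs fs_v v_alt[of 0] by (metis lessI less_numeral_extra(3) mult_eq_0_iff zero_less_Suc)
    then have "1 \<le> changes_upto ?w (R 0)"
      using sgn_changes_upto[of ?w "R 0"] \<open>?w (R 0) < 0\<close> by (cases "changes_upto ?w (R 0)") auto
    then have "1 + r \<le> changes_upto ?w (R r)"
      by (intro changes_upto_alternating[OF R w_alt]) auto
    then have "enat (Suc r) \<le> variation ?w"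
      using enat_le_variation_iff by auto
    then show False using eq var_v by simp
  qed
qed

text \<open>\<open>J\<close> holds the positions that inputs can occupy: \<open>{..<n}\<close> for
  states and \<open>UNIV\<close> for past inputs. Finitely supported sequences suffice to detect a
  negative minor, so \<open>D\<close> only has to represent those.\<close>

lemma ovd_iff_minors_nonneg:
  assumes sums: "\<And>u i. u \<in> D \<Longrightarrow> (\<lambda>j. M i j * \<sigma> u j) sums \<tau> (X u) i"
    and D: "\<And>v. finite {j. v j \<noteq> 0} \<Longrightarrow> {j. v j \<noteq> 0} \<subseteq> J \<Longrightarrow> v \<in> \<sigma> ` D"
    and J: "\<And>i j. j \<notin> J \<Longrightarrow> M i j = 0"
  shows "ovd m D \<sigma> \<tau> X \<longleftrightarrow> all_minors_nonneg (Suc m) UNIV UNIV M"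
proof
  assume ovd: "ovd m D \<sigma> \<tau> X"
  show "all_minors_nonneg (Suc m) UNIV UNIV M"
    unfolding all_minors_nonneg_def
  proof (intro allI impI)
    fix r and R C :: "nat \<Rightarrow> nat"
    assume rc: "r \<le> Suc m" "strict_mono_on {..<r} R" "strict_mono_on {..<r} C"
    show "0 \<le> minor r M R C"
    proof (cases "C ` {..<r} \<subseteq> J")
      case True
      then show ?thesis using ovd_imp_minor_nonneg[OF ovd sums D] rc by blast
    next
      case False
      then obtain j where "j < r" "C j \<notin> J" by auto
      then have "minor r M R C = 0" by (intro minor_zero_col[of j]) (auto simp: J)
      then show ?thesis by simp
    qed
  qed
next
  assume "all_minors_nonneg (Suc m) UNIV UNIV M"
  then show "ovd m D \<sigma> \<tau> X"
    unfolding ovd_def using minors_nonneg_imp_variation_diminishing sums by blast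
qed

subsection \<open>Strictly totally positive kernels close to the identity\<close>

text \<open>The squared distance. Under truncated subtraction one of the two terms vanishes, so the
  result is a natural number and can be an exponent.\<close>

definition sq_dist :: "nat \<Rightarrow> nat \<Rightarrow> nat" where
  "sq_dist i j = (i - j)\<^sup>2 + (j - i)\<^sup>2"

lemma int_sq_dist: "int (sq_dist i j) = (int i - int j)\<^sup>2"
  by (cases i j rule: linorder_cases) (auto simp: sq_dist_def of_nat_diff power2_commute)

text \<open>Uncrossing two pairs lowers the cost: the left side minus the right side is
  \<open>2 * (a - b) * (x - y)\<close>.\<close>

lemma sq_dist_exchange:
  assumes "a < b" "y < x"
  shows "sq_dist a y + sq_dist b x < sq_dist a x + sq_dist b y"
proof -
  have "(int a - int b) * (int x - int y) < 0"
    using assms by (intro mult_neg_pos) auto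
  then have "int (sq_dist a y + sq_dist b x) < int (sq_dist a x + sq_dist b y)"
    by (simp add: int_sq_dist power2_eq_square algebra_simps)
  then show ?thesis by (simp only: of_nat_less_iff)
qed

lemma permutes_adjacent_descent:
  assumes p: "p permutes {0..<r}" and "p \<noteq> id"
  obtains i where "Suc i < r" "p (Suc i) < p i"
proof -
  have "\<exists>i. Suc i < r \<and> p (Suc i) < p i"
  proof (rule ccontr)
    assume "\<nexists>i. Suc i < r \<and> p (Suc i) < p i"
    then have le: "p i \<le> p (Suc i)" if "Suc i < r" for i using that by (meson not_le)
    have lt: "p i < p (Suc i)" if "Suc i < r" for i
    proof -
      have "p i \<noteq> p (Suc i)" using permutes_inj[OF p] by (simp add: inj_eq)
      then show ?thesis using le[OF that] by simp
    qed
    have "i < r \<Longrightarrow> i \<le> p i" for i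
    proof (induction i)
      case (Suc i)
      then show ?case using lt[of i] by simp
    qed simp
    then have "p = id" by (intro permutes_natset_ge[OF p]) auto
    then show False using assms(2) by simp
  qed
  then show thesis using that by blast
qed

text \<open>Bubble sort: undoing an adjacent descent of \<open>p\<close> uncrosses two pairs and
  strictly lowers the sum, which serves as the induction measure. Sorting ends at the
  identity.\<close>

lemma sum_sq_dist_minimal:
  fixes r :: nat
  assumes R: "strict_mono_on {..<r} R" and C: "strict_mono_on {..<r} C"
    and "p permutes {0..<r}" "p \<noteq> id"
  shows "(\<Sum>i = 0..<r. sq_dist (R i) (C i)) < (\<Sum>i = 0..<r. sq_dist (R i) (C (p i)))"
  using assms(3,4)
proof (induction "\<Sum>i = 0..<r. sq_dist (R i) (C (p i))" arbitrary: p rule: less_induct)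
  case less
  note p = less.prems(1)
  obtain i where i: "Suc i < r" "p (Suc i) < p i"
    using permutes_adjacent_descent[OF less.prems] .
  let ?q = "p \<circ> Transposition.transpose i (Suc i)"
  have q: "?q permutes {0..<r}"
    by (rule permutes_compose[OF permutes_swap_id p]) (use i in auto)
  have split: "(\<Sum>j = 0..<r. f j) = f i + f (Suc i) + sum f ({0..<r} - {i, Suc i})" for f :: "nat \<Rightarrow> nat"
    using sum.subset_diff[of "{i, Suc i}" "{0..<r}" f] i by simp
  have bound: "p j < r" if "j < r" for j
    using permutes_in_image[OF p, of j] that by simp
  have "R i < R (Suc i)" using R i by (auto simp: strict_mono_on_def)
  moreover have "C (p (Suc i)) < C (p i)"
    using C i bound[of i] bound[of "Suc i"] by (auto simp: strict_mono_on_def)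
  ultimately have "sq_dist (R i) (C (?q i)) + sq_dist (R (Suc i)) (C (?q (Suc i))) <
      sq_dist (R i) (C (p i)) + sq_dist (R (Suc i)) (C (p (Suc i)))"
    by (simp add: sq_dist_exchange)
  moreover have "(\<Sum>j\<in>{0..<r} - {i, Suc i}. sq_dist (R j) (C (?q j))) =
      (\<Sum>j\<in>{0..<r} - {i, Suc i}. sq_dist (R j) (C (p j)))"
    by (intro sum.cong) (auto simp: Transposition.transpose_def)
  ultimately have less_q: "(\<Sum>j = 0..<r. sq_dist (R j) (C (?q j))) < (\<Sum>j = 0..<r. sq_dist (R j) (C (p j)))"
    unfolding split[of "\<lambda>j. sq_dist (R j) (C (?q j))"] split[of "\<lambda>j. sq_dist (R j) (C (p j))"]
    by linarith
  show ?case
  proof (cases "?q = id")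
    case True
    have "?q j = j" for j using True by (metis id_apply)
    then show ?thesis using less_q by simp
  next
    case False
    then show ?thesis using less.hyps[OF less_q q] less_q by linarith
  qed
qed

text \<open>A discrete Gaussian. Since \<open>0 ^ 0 = 1\<close>, it is the identity matrix at
  \<open>q = 0\<close>.\<close>

definition gauss_kernel :: "real \<Rightarrow> nat \<Rightarrow> nat \<Rightarrow> real" where
  "gauss_kernel q i j = q ^ sq_dist i j"

text \<open>
  By the rearrangement inequality the identity permutation has the strictly smallest exponent,
  so its term dominates the determinant as \<open>q\<close> tends to 0.
\<close>

lemma minor_gauss_kernel_pos:
  assumes R: "strict_mono_on {..<r} R" and C: "strict_mono_on {..<r} C"
  shows "\<forall>\<^sub>F q in at_right 0. 0 < minor r (gauss_kernel q) R C"
proof -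
  let ?P = "{p. p permutes {0..<r}}"
  let ?cost = "\<lambda>p. \<Sum>i = 0..<r. sq_dist (R i) (C (p i))"
  let ?f = "\<lambda>q :: real. \<Sum>p\<in>?P. signof p * q ^ (?cost p - ?cost id)"
  have lt: "?cost id < ?cost p" if "p \<in> ?P" "p \<noteq> id" for p
    using sum_sq_dist_minimal[OF R C] that by simp
  have factor: "minor r (gauss_kernel q) R C = q ^ ?cost id * ?f q" for q
  proof -
    have "(\<Prod>i = 0..<r. gauss_kernel q (R i) (C (p i))) = q ^ ?cost id * q ^ (?cost p - ?cost id)"
      if "p \<in> ?P" for p
    proof -
      have "?cost id \<le> ?cost p" using lt[OF that] by (cases "p = id") auto
      then show ?thesis
        unfolding gauss_kernel_def power_sum[symmetric] by (simp flip: power_add)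
    qed
    then show ?thesis
      unfolding minor_eq_sum sum_distrib_left by (intro sum.cong) (auto simp: mult_ac)
  qed
  have "((\<lambda>q. ?f q) \<longlongrightarrow> (\<Sum>p\<in>?P. signof p * 0 ^ (?cost p - ?cost id))) (at_right 0)"
    by (intro tendsto_intros)
  also have "(\<Sum>p\<in>?P. signof p * (0 :: real) ^ (?cost p - ?cost id)) =
      (\<Sum>p\<in>?P. if p = id then 1 else 0)"
  proof (intro sum.cong refl)
    fix p assume p: "p \<in> ?P"
    show "signof p * (0 :: real) ^ (?cost p - ?cost id) = (if p = id then 1 else 0)"
      using lt[OF p] by (cases "p = id") auto
  qed
  also have "\<dots> = 1" by (simp add: finite_permutations permutes_id)
  finally have "\<forall>\<^sub>F q in at_right 0. 0 < ?f q"
    by (rule order_tendstoD) simp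
  moreover have "\<forall>\<^sub>F q in at_right (0 :: real). 0 < q"
    by (simp add: eventually_at_right_less)
  ultimately show ?thesis
    by eventually_elim (simp add: factor)
qed

section \<open>Increasing choices of rows and columns\<close>

definition index_map :: "nat \<Rightarrow> nat \<Rightarrow> (nat \<Rightarrow> nat) \<Rightarrow> bool" where
  "index_map r n R \<longleftrightarrow> strict_mono_on {..<r} R \<and> R ` {..<r} \<subseteq> {..<n}"

lemma index_map_less: "index_map r n R \<Longrightarrow> i < r \<Longrightarrow> R i < n"
  by (auto simp: index_map_def)

lemma index_map_le: "index_map r n R \<Longrightarrow> r' \<le> r \<Longrightarrow> index_map r' n R"
  by (auto simp: index_map_def strict_mono_on_def image_subset_iff)

lemma index_map_insert_index: "index_map (Suc r) n R \<Longrightarrow> index_map r n (R \<circ> insert_index i)"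
  by (auto simp: index_map_def strict_mono_on_def insert_index_def image_subset_iff)

lemma index_map_pick: "L \<subseteq> {..<n} \<Longrightarrow> card L = r \<Longrightarrow> index_map r n (pick L)"
  using strict_mono_on_pick[of L r] pick_image[of L r] finite_subset[of L "{..<n}"]
  by (auto simp: index_map_def)

lemma index_map_image: "index_map r n R \<Longrightarrow> R ` {..<r} \<subseteq> {..<n} \<and> card (R ` {..<r}) = r"
  by (auto simp: index_map_def card_image strict_mono_on_imp_inj_on)

lemma minor_pick:
  assumes "index_map r n R" "index_map r m C"
  shows "minor r M (pick (R ` {..<r})) (pick (C ` {..<r})) = minor r M R C"
  using assms by (intro minor_cong) (simp add: pick_strict_mono_image index_map_def)

text \<open>A single \<open>q\<close> must serve all minors. A minor depends only on the images of
  \<open>R\<close> and \<open>C\<close>, so finitely many conditions have to hold together near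
  0.\<close>

lemma gauss_kernel_totally_positive:
  "\<forall>\<^sub>F q in at_right 0. \<forall>r R C. index_map r n R \<longrightarrow> index_map r n C \<longrightarrow> 0 < minor r (gauss_kernel q) R C"
proof -
  let ?S = "{(L, K). L \<subseteq> {..<n} \<and> K \<subseteq> {..<n} \<and> card L = card K}"
  have "finite ?S"
    by (rule finite_subset[of _ "Pow {..<n} \<times> Pow {..<n}"]) auto
  then have "\<forall>\<^sub>F q in at_right 0. \<forall>(L, K)\<in>?S. 0 < minor (card L) (gauss_kernel q) (pick L) (pick K)"
    by (rule eventually_ball_finite) (auto intro!: minor_gauss_kernel_pos strict_mono_on_pick)
  then show ?thesis
  proof eventually_elim
    case (elim q)
    show ?case
    proof (intro allI impI)
      fix r R C assume RC: "index_map r n R" "index_map r n C"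
      then have S: "(R ` {..<r}, C ` {..<r}) \<in> ?S" and card: "card (R ` {..<r}) = r"
        using index_map_image[of r n R] index_map_image[of r n C] by auto
      show "0 < minor r (gauss_kernel q) R C"
        using bspec[OF elim S] unfolding prod.case card minor_pick[OF RC] .
    qed
  qed
qed

lemma tendsto_minor_gauss_kernel:
  assumes "\<And>i. i < r \<Longrightarrow> R i < n"
  shows "((\<lambda>q. minor r (\<lambda>i j. \<Sum>l<n. gauss_kernel q i l * X l j) R C) \<longlongrightarrow> minor r X R C) (at_right 0)"
proof -
  have "((\<lambda>q. minor r (\<lambda>i j. \<Sum>l<n. gauss_kernel q i l * X l j) R C) \<longlongrightarrow>
      minor r (\<lambda>i j. \<Sum>l<n. gauss_kernel 0 i l * X l j) R C) (at_right 0)"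
    unfolding minor_eq_sum gauss_kernel_def by (intro tendsto_intros)
  also have "minor r (\<lambda>i j. \<Sum>l<n. gauss_kernel 0 i l * X l j) R C = minor r X R C"
  proof (rule minor_cong)
    fix i j assume "i < r"
    have "gauss_kernel 0 (R i) l = (if R i = l then 1 else 0)" for l
      by (auto simp: gauss_kernel_def sq_dist_def power_0_left)
    then show "(\<Sum>l<n. gauss_kernel 0 (R i) l * X l (C j)) = X (R i) (C j)"
      using assms[OF \<open>i < r\<close>] by (simp add: if_distrib[of "\<lambda>x. x * _"] cong: if_cong)
  qed
  finally show ?thesis .
qed

subsection \<open>Minors of Krylov matrices\<close>

lemma insert_index_Suc_Suc: "0 < s \<Longrightarrow> insert_index s (Suc i) = Suc (insert_index (s - 1) i)"
  by (auto simp: insert_index_def)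

text \<open>Cramer's relation among \<open>r + 2\<close> columns of height \<open>r + 1\<close>: put
  a second copy of row \<open>i\<close> on top and expand the resulting zero determinant along
  it.\<close>

lemma sum_minors_eq_0:
  assumes "i < Suc r"
  shows "(\<Sum>l<Suc (Suc r). (-1) ^ l * M (R i) (E l) * minor (Suc r) M R (E \<circ> insert_index l)) = 0"
proof -
  let ?R = "\<lambda>a. case a of 0 \<Rightarrow> R i | Suc a \<Rightarrow> R a"
  have "minor (Suc (Suc r)) M ?R E = 0"
    by (rule minor_identical_rows[of 0 _ "Suc i"]) (use assms in auto)
  moreover have "?R \<circ> insert_index 0 = R"
    by (auto simp: insert_index_def)
  ultimately show ?thesis
    using minor_expand_row[of 0 "Suc r" M ?R E] by simp
qed

text \<open>Let \<open>D\<close> be the columns \<open>E\<close> without those at \<open>0\<close>,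
  \<open>s\<close> and the last position. The functional \<open>\<psi>\<close>, the determinant with
  one free column in front of \<open>D\<close>, is applied to the linear relation among all
  \<open>m + 3\<close> columns. It vanishes on \<open>D\<close>, so three terms survive.\<close>

lemma three_term_Pluecker:
  assumes s: "0 < s" "s \<le> Suc m"
  shows "minor (Suc m) M R (E \<circ> Suc) * minor (Suc (Suc m)) M R (E \<circ> insert_index s) =
    minor (Suc m) M R (E \<circ> insert_index s \<circ> Suc) * minor (Suc (Suc m)) M R E +
    minor (Suc m) M R (E \<circ> insert_index s) * minor (Suc (Suc m)) M R (E \<circ> Suc)"
proof -
  define D where "D = (\<lambda>i. E (Suc (insert_index (s - 1) i)))"
  define \<psi> where "\<psi> x = (\<Sum>i<Suc m. (-1) ^ i * M (R i) x * minor m M (R \<circ> insert_index i) D)" for x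
  have sgn: "(-1) ^ (i + l) * x * y = (-1) ^ l * ((-1) ^ i * x * y)" for i l and x y :: real
    by (simp add: power_add)
  have E_Suc: "minor (Suc m) M R (E \<circ> Suc) = (-1) ^ (s - 1) * \<psi> (E s)"
  proof -
    have "E \<circ> Suc \<circ> insert_index (s - 1) = D" by (auto simp: D_def)
    then show ?thesis
      using minor_expand_col[of "s - 1" m M R "E \<circ> Suc"] s
      unfolding \<psi>_def sum_distrib_left sgn by simp
  qed
  have E_last: "minor (Suc m) M R (E \<circ> insert_index s \<circ> Suc) = (-1) ^ m * \<psi> (E (Suc (Suc m)))"
  proof -
    have "minor m M (R \<circ> insert_index i) (E \<circ> insert_index s \<circ> Suc \<circ> insert_index m) =
        minor m M (R \<circ> insert_index i) D" for i
      by (rule minor_cong) (simp add: D_def insert_index_Suc_Suc[OF s(1)])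
    moreover have "(E \<circ> insert_index s \<circ> Suc) m = E (Suc (Suc m))"
      using s by simp
    ultimately show ?thesis
      using minor_expand_col[of m m M R "E \<circ> insert_index s \<circ> Suc"]
      unfolding \<psi>_def sum_distrib_left sgn by simp
  qed
  have E_first: "minor (Suc m) M R (E \<circ> insert_index s) = \<psi> (E 0)"
  proof -
    have "E \<circ> insert_index s \<circ> insert_index 0 = D"
      by (auto simp: D_def insert_index_Suc_Suc[OF s(1)])
    then show ?thesis
      using minor_expand_col[of 0 m M R "E \<circ> insert_index s"] s by (simp add: \<psi>_def)
  qed
  have \<psi>_D: "\<psi> (D i) = 0" if "i < m" for i
  proof -
    let ?C = "\<lambda>a. case a of 0 \<Rightarrow> D i | Suc a \<Rightarrow> D a"
    have "minor (Suc m) M R ?C = 0"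
      by (rule minor_identical_cols[of 0 _ "Suc i"]) (use that in auto)
    moreover have "?C \<circ> insert_index 0 = D" by (auto simp: insert_index_def)
    ultimately show ?thesis
      using minor_expand_col[of 0 m M R ?C] by (simp add: \<psi>_def)
  qed
  let ?g = "\<lambda>l. (-1) ^ l * minor (Suc (Suc m)) M R (E \<circ> insert_index l) * \<psi> (E l)"
  have "(\<Sum>l<Suc (Suc (Suc m)). ?g l) =
      (\<Sum>i<Suc m. (-1) ^ i * minor m M (R \<circ> insert_index i) D *
        (\<Sum>l<Suc (Suc (Suc m)). (-1) ^ l * M (R i) (E l) * minor (Suc (Suc m)) M R (E \<circ> insert_index l)))"
    unfolding \<psi>_def sum_distrib_left by (subst sum.swap) (simp only: mult_ac)
  also have "\<dots> = 0"
    by (intro sum.neutral ballI) (simp only: sum_minors_eq_0 lessThan_iff less_Suc_eq mult_zero_right simp_thms)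
  finally have zero: "(\<Sum>l<Suc (Suc (Suc m)). ?g l) = 0" .
  have "(\<Sum>l<Suc (Suc (Suc m)). ?g l) = (\<Sum>l\<in>{0, s, Suc (Suc m)}. ?g l)"
  proof (rule sum.mono_neutral_right)
    show "\<forall>l\<in>{..<Suc (Suc (Suc m))} - {0, s, Suc (Suc m)}. ?g l = 0"
    proof
      fix l assume l: "l \<in> {..<Suc (Suc (Suc m))} - {0, s, Suc (Suc m)}"
      \<comment> \<open>The position in \<open>D\<close> of column \<open>l\<close>: one removed
        column precedes it if \<open>l < s\<close>, two if \<open>l > s\<close>.\<close>
      define i where "i = (if l < s then l - 1 else l - 2)"
      have "i < m" "E l = D i"
        using l s by (auto simp: i_def D_def insert_index_def intro!: arg_cong[where f = E])
      then show "?g l = 0" using \<psi>_D by simp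
    qed
  qed (use s in auto)
  also have "\<dots> = ?g 0 + ?g s + ?g (Suc (Suc m))" using s by simp
  finally have sum3: "?g 0 + ?g s + ?g (Suc (Suc m)) = 0" using zero by simp
  have "E \<circ> insert_index 0 = E \<circ> Suc" by (auto simp: insert_index_def)
  then have g0: "?g 0 = minor (Suc m) M R (E \<circ> insert_index s) * minor (Suc (Suc m)) M R (E \<circ> Suc)"
    by (simp add: E_first)
  have "(-1 :: real) ^ s = - ((-1) ^ (s - 1))" using s by (cases s) auto
  then have gs: "?g s = - (minor (Suc m) M R (E \<circ> Suc) * minor (Suc (Suc m)) M R (E \<circ> insert_index s))"
    unfolding E_Suc by simp
  have "minor (Suc (Suc m)) M R (E \<circ> insert_index (Suc (Suc m))) = minor (Suc (Suc m)) M R E"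
    by (rule minor_cong) simp
  then have gl: "?g (Suc (Suc m)) = minor (Suc m) M R (E \<circ> insert_index s \<circ> Suc) * minor (Suc (Suc m)) M R E"
    unfolding E_last by simp
  show ?thesis using sum3 unfolding g0 gs gl by linarith
qed

text \<open>Repeated expansion along the first column leaves only minors in the last
  \<open>l\<close> columns.\<close>

lemma minor_zero_of_tail:
  assumes "\<And>R. index_map l n R \<Longrightarrow> minor l M R (\<lambda>b. C (b + i)) = 0" and "index_map (l + i) n R"
  shows "minor (l + i) M R C = 0"
  using assms
proof (induction i arbitrary: C R)
  case 0
  then show ?case by simp
next
  case (Suc i)
  have "minor (l + i) M (R \<circ> insert_index a) (C \<circ> insert_index 0) = 0" for a
  proof (rule Suc.IH)
    show "minor l M R (\<lambda>b. (C \<circ> insert_index 0) (b + i)) = 0" if "index_map l n R" for R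
      using Suc.prems(1)[OF that] by (simp add: insert_index_def)
    show "index_map (l + i) n (R \<circ> insert_index a)"
      using Suc.prems(2) by (simp add: index_map_insert_index)
  qed
  then show ?case
    using minor_expand_col[of 0 "l + i" M R C] by simp
qed

section \<open>Fekete's induction with degenerate columns\<close>

lemma consecutive_if_no_gap:
  assumes "\<And>i. Suc i < j \<Longrightarrow> C (Suc i) = Suc (C i)" "i < j"
  shows "C i = C 0 + i"
  using assms(2) by (induction i) (use assms(1) in auto)

text \<open>
  Read \<open>z p l\<close> as: the \<open>l\<close> consecutive columns from \<open>p\<close> on are linearly dependent.
\<close>

lemma Fekete_minor_pos:
  assumes pos: "\<And>p l R. l \<le> k \<Longrightarrow> \<not> z p l \<Longrightarrow> index_map l n R \<Longrightarrow> 0 < minor l Y R (\<lambda>j. p + j)"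
    and zero: "\<And>p l R C. l \<le> k \<Longrightarrow> z p l \<Longrightarrow> index_map l n R \<Longrightarrow> strict_mono_on {..<l} C \<Longrightarrow>
      (\<And>i. i < l \<Longrightarrow> p \<le> C i) \<Longrightarrow> minor l Y R C = 0"
    and mono: "\<And>p p' l. z p l \<Longrightarrow> p \<le> p' \<Longrightarrow> z p' l"
    and "j \<le> k" "index_map j n R" "strict_mono_on {..<j} C"
  shows "(if \<forall>i<j. \<not> z (C i) (j - i) then 0 < minor j Y R C else minor j Y R C = 0)"
proof -
  have bad: "minor j Y R C = 0"
    if "j \<le> k" "index_map j n R" "strict_mono_on {..<j} C" "i < j" "z (C i) (j - i)" for i j R C
  proof -
    have "minor (j - i) Y R' (\<lambda>b. C (b + i)) = 0" if "index_map (j - i) n R'" for R'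
    proof (rule zero[OF _ \<open>z (C i) (j - i)\<close> that])
      show "strict_mono_on {..<j - i} (\<lambda>b. C (b + i))"
        using \<open>strict_mono_on {..<j} C\<close> by (auto simp: strict_mono_on_def less_diff_conv)
      show "C i \<le> C (b + i)" if "b < j - i" for b
        using \<open>strict_mono_on {..<j} C\<close> that
        by (cases "b = 0") (auto simp: strict_mono_on_def less_diff_conv intro!: less_imp_le)
    qed (use \<open>j \<le> k\<close> in simp)
    then have "minor (j - i + i) Y R C = 0"
      by (rule minor_zero_of_tail[where n = n]) (use that in auto)
    then show ?thesis using \<open>i < j\<close> by simp
  qed
  have good: "0 < minor j Y R C"
    if "j \<le> k" "index_map j n R" "strict_mono_on {..<j} C" "\<And>i. i < j \<Longrightarrow> \<not> z (C i) (j - i)" for j R C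
    using that
  proof (induction j arbitrary: R C)
    case 0
    then show ?case by simp
  next
    case (Suc j)
    note outer = Suc.IH
    show ?case
      using Suc.prems(2-)
    proof (induction "C j - C 0" arbitrary: R C rule: less_induct)
      case less
      note R = less.prems(1) and C = less.prems(2) and nz = less.prems(3)
      \<comment> \<open>A smaller spread gives nonnegativity in any case: by the inner induction if
        no tail is degenerate, and by \<open>bad\<close> otherwise.\<close>
      have nonneg: "0 \<le> minor (Suc j) Y R C'"
        if "strict_mono_on {..<Suc j} C'" "C' j - C' 0 < C j - C 0" for C'
      proof (cases "\<forall>i<Suc j. \<not> z (C' i) (Suc j - i)")
        case True
        then show ?thesis using less.hyps[OF that(2) R that(1)] by fastforce
      next
        case False
        then show ?thesis using bad[OF Suc.prems(1) R that(1)] by fastforce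
      qed
      show ?case
      proof (cases "\<exists>i. Suc i < Suc j \<and> C (Suc i) \<noteq> Suc (C i)")
        case False
        then have C_eq: "C i = C 0 + i" if "i < Suc j" for i
          using consecutive_if_no_gap[of "Suc j" C i] that by blast
        have "minor (Suc j) Y R C = minor (Suc j) Y R (\<lambda>i. C 0 + i)"
          by (rule minor_cong) (rule arg_cong[OF C_eq])
        moreover have "\<not> z (C 0) (Suc j)" using nz[of 0] by simp
        ultimately show ?thesis
          using pos[OF Suc.prems(1) _ R, of "C 0"] by presburger
      next
        case True
        then obtain i where i: "Suc i < Suc j" "C (Suc i) \<noteq> Suc (C i)" by blast
        \<comment> \<open>\<open>E\<close> inserts into \<open>C\<close> the column that is missing
          right after \<open>C i\<close>. Omitting its last or its first column leaves the same
          order with smaller spread.\<close>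
        define E where "E a = (if a \<le> i then C a else if a = Suc i then Suc (C i) else C (a - 1))" for a
        have C_less: "C a < C b" if "a < b" "b < Suc j" for a b
          using C that by (auto simp: strict_mono_on_def)
        have gap: "Suc (C i) < C (Suc i)" using C_less[of i "Suc i"] i by simp
        have E_less: "E a < E b" if "a < b" "b < Suc (Suc j)" for a b
        proof -
          have "E a < E (Suc a)" if "a < Suc j" for a
            using C_less[of a "Suc a"] C_less[of "a - 1" a] gap i that
            by (cases a i rule: linorder_cases) (auto simp: E_def not_less_eq_eq le_Suc_eq)
          then show ?thesis
            using that(1,2) by (induction b) (auto simp: less_Suc_eq intro: less_trans)
        qed
        have E_le: "E a \<le> C a" if "a < Suc j" for a
          using C_less[of "a - 1" a] gap i that by (auto simp: E_def not_le)
        have E_C: "E \<circ> insert_index (Suc i) = C"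
          by (auto simp: E_def insert_index_def fun_eq_iff)
        obtain m where m: "j = Suc m" using i by (cases j) auto
        have Pl: "minor (Suc m) Y R (E \<circ> Suc) * minor (Suc j) Y R C =
            minor (Suc m) Y R (C \<circ> Suc) * minor (Suc j) Y R E +
            minor (Suc m) Y R C * minor (Suc j) Y R (E \<circ> Suc)"
          using three_term_Pluecker[of "Suc i" m Y R E] i unfolding E_C m by simp
        have Rm: "index_map (Suc m) n R" using R m index_map_le[of "Suc j" n R "Suc m"] by simp
        \<comment> \<open>Dropping the first column leaves \<open>j - a\<close> columns from
          position \<open>a\<close> on, exactly the tail length of \<open>C\<close> at
          \<open>Suc a\<close>. Nondegeneracy there passes to any earlier starting column
          \<open>x\<close>.\<close>
        have z_shift: "\<not> z x (j - a)" if "a < j" "x \<le> C (Suc a)" for x a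
          using nz[of "Suc a"] that mono by fastforce
        have 1: "0 < minor (Suc m) Y R (E \<circ> Suc)"
        proof (rule outer[unfolded m])
          show "strict_mono_on {..<Suc m} (E \<circ> Suc)"
            using E_less by (auto simp: strict_mono_on_def m)
          show "\<not> z ((E \<circ> Suc) a) (Suc m - a)" if "a < Suc m" for a
            using z_shift[of a "E (Suc a)"] E_le[of "Suc a"] that by (simp add: m)
        qed (use Suc.prems(1) Rm m in auto)
        have 2: "0 < minor (Suc m) Y R (C \<circ> Suc)"
        proof (rule outer[unfolded m])
          show "strict_mono_on {..<Suc m} (C \<circ> Suc)"
            using C_less by (auto simp: strict_mono_on_def m)
          show "\<not> z ((C \<circ> Suc) a) (Suc m - a)" if "a < Suc m" for a
            using z_shift[of a "C (Suc a)"] that by (simp add: m)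
        qed (use Suc.prems(1) Rm m in auto)
        have 3: "0 < minor (Suc j) Y R E"
        proof (rule less.hyps)
          have "E j < C j"
            using C_less[of "j - 1" j] gap i by (auto simp: E_def not_le)
          moreover have "E 0 = C 0" by (simp add: E_def)
          ultimately show "E j - E 0 < C j - C 0"
            using C_less[of 0 j] E_less[of 0 j] m by simp
          show "strict_mono_on {..<Suc j} E"
            using E_less by (auto simp: strict_mono_on_def)
          show "\<not> z (E a) (Suc j - a)" if "a < Suc j" for a
            using nz[OF that] E_le[OF that] mono by blast
        qed (rule R)
        \<comment> \<open>For the factors in 4 and 5 nonnegativity is enough, since the product of 2
          and 3 is already positive.\<close>
        have 4: "0 \<le> minor (Suc m) Y R C"
        proof (cases "\<forall>i<Suc m. \<not> z (C i) (Suc m - i)")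
          case True
          then show ?thesis
            using outer[unfolded m, of R C] Suc.prems(1) Rm C_less m
            by (auto simp: strict_mono_on_def intro!: less_imp_le)
        next
          case False
          then obtain a where "a < Suc m" "z (C a) (Suc m - a)" by blast
          then have "minor (Suc m) Y R C = 0"
            using Suc.prems(1) Rm C_less m by (intro bad[of "Suc m" R C a]) (auto simp: strict_mono_on_def)
          then show ?thesis by simp
        qed
        have 5: "0 \<le> minor (Suc j) Y R (E \<circ> Suc)"
        proof (rule nonneg)
          show "strict_mono_on {..<Suc j} (E \<circ> Suc)"
            using E_less by (auto simp: strict_mono_on_def)
          have "E (Suc j) = C j" "E 0 = C 0" using i by (auto simp: E_def)
          then show "(E \<circ> Suc) j - (E \<circ> Suc) 0 < C j - C 0"
            using E_less[of 0 1] C_less[of 0 j] E_le[of 1] m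
            by (simp add: diff_less_mono2)
        qed
        have "0 < minor (Suc m) Y R (E \<circ> Suc) * minor (Suc j) Y R C"
          unfolding Pl using 2 3 4 5 by (intro add_pos_nonneg mult_pos_pos mult_nonneg_nonneg)
        then show ?thesis using 1 by (simp add: zero_less_mult_iff)
      qed
    qed
  qed
  show ?thesis
    using good[OF assms(4-6)] bad[OF assms(4-6)] by auto
qed

text \<open>
  By Cauchy--Binet the Gram determinant is the sum of the squares of the minors.
\<close>

lemma minors_zero_kernel:
  assumes "\<And>R. index_map l n R \<Longrightarrow> minor l X R (\<lambda>j. p + j) = 0"
  obtains v b where "b < l" "v b \<noteq> 0" "\<And>i. i < n \<Longrightarrow> (\<Sum>b<l. X i (p + b) * v b) = (0 :: real)"
proof -
  let ?G = "\<lambda>a b. \<Sum>i<n. X i (p + a) * X i (p + b)"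
  have "minor l ?G (\<lambda>i. i) (\<lambda>j. j) = (\<Sum>L | L \<subseteq> {..<n} \<and> card L = l.
      minor l (\<lambda>a i. X i (p + a)) (\<lambda>i. i) (pick L) * minor l (\<lambda>i b. X i (p + b)) (pick L) (\<lambda>j. j))"
    by (rule Cauchy_Binet_minor)
  also have "\<dots> = 0"
  proof (rule sum.neutral, rule ballI)
    fix L assume "L \<in> {L. L \<subseteq> {..<n} \<and> card L = l}"
    then have "minor l X (pick L) (\<lambda>j. p + j) = 0"
      by (intro assms index_map_pick) auto
    then show "minor l (\<lambda>a i. X i (p + a)) (\<lambda>i. i) (pick L) *
        minor l (\<lambda>i b. X i (p + b)) (pick L) (\<lambda>j. j) = 0"
      by (simp add: minor_def)
  qed
  finally obtain v b where v: "b < l" "v b \<noteq> 0" "\<And>a. a < l \<Longrightarrow> (\<Sum>b<l. ?G a b * v b) = 0"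
    using minor_zero_kernel by blast
  let ?s = "\<lambda>i. \<Sum>b<l. X i (p + b) * v b"
  \<comment> \<open>The quadratic form of the Gram matrix at \<open>v\<close> is the squared length
    of the combination \<open>?s\<close>, so a kernel vector of the former makes the latter
    vanish.\<close>
  have "(\<Sum>i<n. ?s i * ?s i) = (\<Sum>i<n. \<Sum>a<l. \<Sum>b<l. v a * (X i (p + a) * X i (p + b) * v b))"
    unfolding sum_product by (simp add: mult_ac)
  also have "\<dots> = (\<Sum>a<l. v a * (\<Sum>b<l. ?G a b * v b))"
    unfolding sum_distrib_left sum_distrib_right
    by (subst sum.swap, rule sum.cong[OF refl], subst sum.swap) simp
  also have "\<dots> = 0" using v(3) by simp
  finally have "?s i * ?s i = 0" if "i < n" for i
    by (subst (asm) sum_nonneg_eq_0_iff) (use that in auto)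
  then show thesis using that v(1,2) by simp
qed

section \<open>Columns generated by a linear recursion\<close>

context
  fixes n :: nat and X F :: "nat \<Rightarrow> nat \<Rightarrow> real"
  assumes step: "\<And>i t. i < n \<Longrightarrow> X i (Suc t) = (\<Sum>l<n. F i l * X l t)"
begin

text \<open>Solving the dependence for its last column \<open>p + d\<close> makes the span of the
  \<open>d\<close> columns before it invariant under \<open>F\<close>. All later columns lie in this
  span, and \<open>d < l\<close> leaves no term in Cauchy--Binet.\<close>

lemma consecutive_minors_zero_imp:
  assumes "\<And>R. index_map l n R \<Longrightarrow> minor l X R (\<lambda>j. p + j) = 0"
    and "index_map l n R" and C: "\<And>i. i < l \<Longrightarrow> p \<le> C i"
  shows "minor l X R C = 0"
proof -
  obtain v b where v: "b < l" "v b \<noteq> 0" "\<And>i. i < n \<Longrightarrow> (\<Sum>b<l. X i (p + b) * v b) = 0"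
    using minors_zero_kernel[OF assms(1)] by blast
  let ?B = "{b. b < l \<and> v b \<noteq> 0}"
  define d where "d = Max ?B"
  have "finite ?B" "?B \<noteq> {}" using v by auto
  then have d: "d < l" "v d \<noteq> 0" and d_max: "\<And>b. b < l \<Longrightarrow> v b \<noteq> 0 \<Longrightarrow> b \<le> d"
    using Max_in[of ?B] Max_ge[of ?B] by (auto simp: d_def)
  have Xd: "X i (p + d) = (\<Sum>b<d. X i (p + b) * (- v b / v d))" if "i < n" for i
  proof -
    have "(\<Sum>b<l. X i (p + b) * v b) = (\<Sum>b<Suc d. X i (p + b) * v b)"
      by (rule sum.mono_neutral_right) (use d d_max in fastforce)+
    then have "X i (p + d) * v d = - (\<Sum>b<d. X i (p + b) * v b)"
      using v(3)[OF that] by simp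
    moreover have "(\<Sum>b<d. X i (p + b) * (- v b / v d)) = - (\<Sum>b<d. X i (p + b) * v b) / v d"
      by (simp add: sum_divide_distrib sum_negf)
    ultimately show ?thesis
      using nonzero_eq_divide_eq[OF d(2)] by presburger
  qed
  \<comment> \<open>A companion matrix: \<open>F\<close> shifts each of the \<open>d\<close> columns
    to the next one, and the last to the combination found in \<open>Xd\<close>.\<close>
  define h where "h b a = (if Suc b = d then - v a / v d else if a = Suc b then 1 else 0)" for b a
  have Xh: "X i (p + Suc b) = (\<Sum>a<d. X i (p + a) * h b a)" if "i < n" "b < d" for i b
  proof (cases "Suc b = d")
    case True
    then show ?thesis using Xd[OF that(1)] by (simp add: h_def)
  next
    case False
    then have "(\<Sum>a<d. X i (p + a) * h b a) = (\<Sum>a<d. if a = Suc b then X i (p + a) else 0)"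
      by (intro sum.cong) (auto simp: h_def)
    then show ?thesis using that False by simp
  qed
  have "\<exists>c. \<forall>i<n. X i (p + t) = (\<Sum>b<d. X i (p + b) * c b)" for t
  proof (induction t)
    case 0
    show ?case
    proof (cases "d = 0")
      case True
      then show ?thesis using Xd by simp
    next
      case False
      have "X i (p + 0) = (\<Sum>b<d. X i (p + b) * (if b = 0 then 1 else 0))" for i
        using False by (simp add: if_distrib[of "\<lambda>x. _ * x"] cong: if_cong)
      then show ?thesis by (intro exI[of _ "\<lambda>b. if b = 0 then 1 else 0"] allI impI)
    qed
  next
    case (Suc t)
    then obtain c where c: "\<And>i. i < n \<Longrightarrow> X i (p + t) = (\<Sum>b<d. X i (p + b) * c b)" by blast
    have "X i (p + Suc t) = (\<Sum>a<d. X i (p + a) * (\<Sum>b<d. c b * h b a))" if "i < n" for i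
    proof -
      have "X i (p + Suc t) = (\<Sum>l<n. F i l * (\<Sum>b<d. X l (p + b) * c b))"
        using step[OF that, of "p + t"] c by simp
      also have "\<dots> = (\<Sum>b<d. c b * (\<Sum>l<n. F i l * X l (p + b)))"
        unfolding sum_distrib_left by (subst sum.swap) (simp add: mult_ac)
      also have "\<dots> = (\<Sum>b<d. c b * (\<Sum>a<d. X i (p + a) * h b a))"
        using step[OF that] Xh[OF that] by (intro sum.cong) auto
      also have "\<dots> = (\<Sum>a<d. X i (p + a) * (\<Sum>b<d. c b * h b a))"
        unfolding sum_distrib_left by (subst sum.swap) (simp add: mult_ac)
      finally show ?thesis .
    qed
    then show ?case by (intro exI[of _ "\<lambda>a. \<Sum>b<d. c b * h b a"] allI impI)
  qed
  then obtain c where c: "\<And>t i. i < n \<Longrightarrow> X i (p + t) = (\<Sum>b<d. X i (p + b) * c t b)"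
    by metis
  have "minor l X R C = minor l (\<lambda>i j. \<Sum>b<d. X i (p + b) * c (j - p) b) R C"
  proof (rule minor_cong)
    fix i j assume "i < l" "j < l"
    then show "X (R i) (C j) = (\<Sum>b<d. X (R i) (p + b) * c (C j - p) b)"
      using c[of "R i" "C j - p"] C[of j] index_map_less[OF assms(2)] by simp
  qed
  also have "\<dots> = (\<Sum>L | L \<subseteq> {..<d} \<and> card L = l.
      minor l (\<lambda>i b. X i (p + b)) R (pick L) * minor l (\<lambda>b j. c (j - p) b) (pick L) C)"
    by (rule Cauchy_Binet_minor)
  also have "{L. L \<subseteq> {..<d} \<and> card L = l} = {}"
  proof -
    have "card L \<le> d" if "L \<subseteq> {..<d}" for L
      using card_mono[OF _ that] by simp
    then have "card L \<noteq> l" if "L \<subseteq> {..<d}" for L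
      using d(1) that not_less by blast
    then show ?thesis by blast
  qed
  finally show ?thesis by simp
qed

theorem Krylov_minors_nonneg:
  assumes F: "all_minors_nonneg k {..<n} {..<n} F"
    and init: "\<And>r R. r \<le> k \<Longrightarrow> index_map r n R \<Longrightarrow> 0 \<le> minor r X R (\<lambda>j. j)"
  shows "all_minors_nonneg k {..<n} UNIV X"
  unfolding all_minors_nonneg_def
proof (intro allI impI)
  have cons: "0 \<le> minor r X R (\<lambda>j. p + j)" if "r \<le> k" "index_map r n R" for r R p
    using that(2)
  proof (induction p arbitrary: R)
    case 0
    then show ?case using init that(1) by simp
  next
    case (Suc p)
    have "minor r X R (\<lambda>j. Suc p + j) = minor r (\<lambda>i j. \<Sum>l<n. F i l * X l j) R (\<lambda>j. p + j)"
      by (rule minor_cong) (use Suc.prems in \<open>simp add: step index_map_less\<close>)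
    also have "\<dots> = (\<Sum>L | L \<subseteq> {..<n} \<and> card L = r.
        minor r F R (pick L) * minor r X (pick L) (\<lambda>j. p + j))"
      by (rule Cauchy_Binet_minor)
    also have "\<dots> \<ge> 0"
    proof (intro sum_nonneg mult_nonneg_nonneg)
      fix L assume "L \<in> {L. L \<subseteq> {..<n} \<and> card L = r}"
      then have L: "index_map r n (pick L)" by (auto intro: index_map_pick)
      then show "0 \<le> minor r X (pick L) (\<lambda>j. p + j)" by (rule Suc.IH)
      show "0 \<le> minor r F R (pick L)"
        using F that(1) L Suc.prems by (auto simp: all_minors_nonneg_def index_map_def)
    qed
    finally show ?case .
  qed
  fix r R and C :: "nat \<Rightarrow> nat"
  assume r: "r \<le> k" and R: "strict_mono_on {..<r} R" "R ` {..<r} \<subseteq> {..<n}"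
    and C: "strict_mono_on {..<r} C"
  have R: "index_map r n R" using R by (simp add: index_map_def)
  let ?Y = "\<lambda>q i j. \<Sum>l<n. gauss_kernel q i l * X l j"
  have "\<forall>\<^sub>F q in at_right 0. 0 \<le> minor r (?Y q) R C"
    using gauss_kernel_totally_positive[of n]
  proof eventually_elim
    case (elim q)
    then have G: "0 < minor r (gauss_kernel q) R C" if "index_map r n R" "index_map r n C" for r R C
      using that by blast
    \<comment> \<open>Degeneracy is read off \<open>X\<close>, not the perturbed matrix.
      \<open>consecutive_minors_zero_imp\<close> makes it persist for larger \<open>p\<close>, and
      Cauchy--Binet carries the zeros over to \<open>?Y q\<close>.\<close>
    define z where "z p l \<longleftrightarrow> (\<forall>R. index_map l n R \<longrightarrow> minor l X R (\<lambda>j. p + j) = 0)" for p l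
    have z: "minor l X R C = 0" if "z p l" "index_map l n R" "\<And>i. i < l \<Longrightarrow> p \<le> C i" for p l R C
      by (rule consecutive_minors_zero_imp[of l p]) (use that in \<open>auto simp: z_def\<close>)
    have "(if \<forall>i<r. \<not> z (C i) (r - i) then 0 < minor r (?Y q) R C else minor r (?Y q) R C = 0)"
    proof (rule Fekete_minor_pos[where k = k and n = n])
      fix p l R assume l: "l \<le> k" "\<not> z p l" and R: "index_map l n R"
      let ?h = "\<lambda>L. minor l (gauss_kernel q) R (pick L) * minor l X (pick L) (\<lambda>j. p + j)"
      \<comment> \<open>A single nonzero minor of \<open>X\<close>, positive by \<open>cons\<close>,
        contributes with positive weight to the minor of \<open>?Y q\<close> in every choice of
        rows.\<close>
      obtain R0 where R0: "index_map l n R0" "minor l X R0 (\<lambda>j. p + j) \<noteq> 0"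
        using l(2) by (auto simp: z_def)
      let ?L0 = "R0 ` {..<l}"
      have "minor l X (pick ?L0) (\<lambda>j. p + j) = minor l X R0 (\<lambda>j. p + j)"
        using R0(1) by (intro minor_cong) (simp add: pick_strict_mono_image index_map_def)
      then have "minor l X (pick ?L0) (\<lambda>j. p + j) > 0"
        using R0 cons[OF l(1) R0(1), of p] by simp
      moreover have L0: "?L0 \<in> {L. L \<subseteq> {..<n} \<and> card L = l}"
        using index_map_image[OF R0(1)] by simp
      ultimately have "0 < ?h ?L0"
        using G[OF R index_map_pick[of ?L0 n l]] by simp
      moreover have "0 \<le> ?h L" if "L \<in> {L. L \<subseteq> {..<n} \<and> card L = l}" for L
        using G[OF R index_map_pick[of L n l]] cons[OF l(1) index_map_pick[of L n l]] that
        by (intro mult_nonneg_nonneg) (auto intro: less_imp_le)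
      ultimately have "0 < (\<Sum>L | L \<subseteq> {..<n} \<and> card L = l. ?h L)"
        using L0 by (intro sum_pos2[where i = ?L0]) auto
      then show "0 < minor l (?Y q) R (\<lambda>j. p + j)"
        by (simp only: Cauchy_Binet_minor)
    next
      fix p l R C
      assume "z p l" "\<And>i. i < l \<Longrightarrow> p \<le> C i"
      then have "minor l X (pick L) C = 0" if "L \<subseteq> {..<n}" "card L = l" for L
        using z index_map_pick[OF that] by blast
      then show "minor l (?Y q) R C = 0"
        unfolding Cauchy_Binet_minor by (intro sum.neutral) auto
    next
      fix p p' l assume "z p l" "p \<le> p'"
      then show "z p' l" using z by (auto simp: z_def)
    qed (fact r R C)+
    then show "0 \<le> minor r (?Y q) R C" by (auto split: if_splits)
  qed
  moreover have "((\<lambda>q. minor r (?Y q) R C) \<longlongrightarrow> minor r X R C) (at_right 0)"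
    by (rule tendsto_minor_gauss_kernel) (use R in \<open>auto dest: index_map_less\<close>)
  ultimately show "0 \<le> minor r X R C"
    by (intro tendsto_lowerbound[where F = "at_right (0 :: real)"]) auto
qed

end

subsection \<open>Compound systems and Hankel operators\<close>

definition nonneg_entries :: "real mat \<Rightarrow> bool" where
  "nonneg_entries M \<longleftrightarrow> (\<forall>i<dim_row M. \<forall>j<dim_col M. 0 \<le> M $$ (i, j))"

text \<open>For necessity, a unit initial state without input shows a column of \<open>F\<close>
  after one step and an entry of \<open>h\<close> at time 0; a unit input from state zero shows
  \<open>g\<close>.\<close>

lemma internally_positive_iff:
  assumes F: "F \<in> carrier_mat N N" and g: "g \<in> carrier_mat N 1" and h: "h \<in> carrier_mat 1 N"
  shows "internally_positive F g h \<longleftrightarrow> nonneg_entries F \<and> nonneg_entries g \<and> nonneg_entries h"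
proof
  assume pos: "internally_positive F g h"
  have P: "0\<^sub>v N \<le> state_traj F g x0 u t \<and> 0 \<le> (h *\<^sub>v state_traj F g x0 u t) $ 0"
    if "\<And>t. 0 \<le> u t" "x0 \<in> carrier_vec N" "0\<^sub>v N \<le> x0" for u x0 t
    using pos F that unfolding internally_positive_def by auto
  have unit: "0\<^sub>v N \<le> (unit_vec N j :: real vec)" for j
    by (auto simp: less_eq_vec_def unit_vec_def)
  have "0 \<le> F $$ (i, j)" if "i < N" "j < N" for i j
  proof -
    have "0\<^sub>v N \<le> state_traj F g (unit_vec N j) (\<lambda>_. 0) (Suc 0)"
      using P[of "\<lambda>_. 0" "unit_vec N j" "Suc 0"] unit by simp
    then have "0 \<le> (F *\<^sub>v unit_vec N j + 0 \<cdot>\<^sub>v col g 0) $ i"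
      using that by (auto simp: less_eq_vec_def)
    then show ?thesis using that F g scalar_prod_right_unit[of j N "row F i"] by simp
  qed
  moreover have "0 \<le> g $$ (i, 0)" if "i < N" for i
  proof -
    have "0\<^sub>v N \<le> state_traj F g (0\<^sub>v N) (\<lambda>_. 1) (Suc 0)"
      using P[of "\<lambda>_. 1" "0\<^sub>v N" "Suc 0"] by simp
    then have "0 \<le> (F *\<^sub>v 0\<^sub>v N + 1 \<cdot>\<^sub>v col g 0) $ i"
      using that by (auto simp: less_eq_vec_def)
    then show ?thesis using that F g by simp
  qed
  moreover have "0 \<le> h $$ (0, j)" if "j < N" for j
  proof -
    have "0 \<le> (h *\<^sub>v unit_vec N j) $ 0"
      using P[of "\<lambda>_. 0" "unit_vec N j" 0] unit by simp
    then show ?thesis using that h scalar_prod_right_unit[of j N "row h 0"] by simp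
  qed
  ultimately show "nonneg_entries F \<and> nonneg_entries g \<and> nonneg_entries h"
    using F g h by (simp add: nonneg_entries_def)
next
  assume nn: "nonneg_entries F \<and> nonneg_entries g \<and> nonneg_entries h"
  have F_nn: "0 \<le> F $$ (i, j)" if "i < N" "j < N" for i j
    using nn F that by (auto simp: nonneg_entries_def)
  have g_nn: "0 \<le> g $$ (i, 0)" if "i < N" for i
    using nn g that by (auto simp: nonneg_entries_def)
  have h_nn: "0 \<le> h $$ (0, j)" if "j < N" for j
    using nn h that by (auto simp: nonneg_entries_def)
  show "internally_positive F g h"
    unfolding internally_positive_def
  proof (intro allI impI)
    fix u :: "nat \<Rightarrow> real" and x0 :: "real vec" and t
    assume u: "\<forall>t. 0 \<le> u t" and x0: "x0 \<in> carrier_vec (dim_row F)" "0\<^sub>v (dim_row F) \<le> x0"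
    have x: "state_traj F g x0 u t \<in> carrier_vec N \<and> (\<forall>i<N. 0 \<le> state_traj F g x0 u t $ i)" for t
    proof (induction t)
      case 0
      then show ?case using x0 F by (auto simp: less_eq_vec_def)
    next
      case (Suc t)
      let ?x = "state_traj F g x0 u t"
      have "0 \<le> (\<Sum>l = 0..<N. F $$ (i, l) * ?x $ l) + u t * g $$ (i, 0)" if "i < N" for i
        using Suc that F_nn g_nn u by (intro add_nonneg_nonneg sum_nonneg mult_nonneg_nonneg) auto
      then show ?case using Suc F g by (auto simp: scalar_prod_def)
    qed
    have "0 \<le> (\<Sum>l = 0..<N. h $$ (0, l) * state_traj F g x0 u t $ l)"
      using x[of t] h_nn by (intro sum_nonneg mult_nonneg_nonneg) auto
    then have "0 \<le> (h *\<^sub>v state_traj F g x0 u t) $ 0"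
      using x[of t] h by (auto simp: scalar_prod_def)
    then show "0\<^sub>v (dim_row F) \<le> state_traj F g x0 u t \<and> 0 \<le> (h *\<^sub>v state_traj F g x0 u t) $ 0"
      using x[of t] F by (auto simp: less_eq_vec_def)
  qed
qed

section \<open>Compound matrices in terms of minors\<close>

lemma det_submatrix_eq_minor:
  assumes "I \<subseteq> {..<dim_row X}" "card I = r" "J \<subseteq> {..<dim_col X}" "card J = r"
  shows "det (submatrix X I J) = minor r (\<lambda>i j. X $$ (i, j)) (pick I) (pick J)"
proof -
  have "{i. i < dim_row X \<and> i \<in> I} = I" "{j. j < dim_col X \<and> j \<in> J} = J"
    using assms by auto
  then show ?thesis
    using assms(2,4) by (simp add: submatrix_def minor_def)
qed

text \<open>Entrywise nonnegativity is insensitive to the order of the index sets, so the range of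
  the enumeration is all that is retained.\<close>

lemma lex_subsets_nth:
  "(\<exists>i<n choose r. set (lex_subsets n r ! i) = I) \<longleftrightarrow> I \<subseteq> {..<n} \<and> card I = r"
proof -
  let ?S = "{I. I \<subseteq> {0..<n} \<and> card I = r}"
  have fin: "finite (sorted_list_of_set ` ?S)" by simp
  have "(\<exists>i<n choose r. set (lex_subsets n r ! i) = I) \<longleftrightarrow> I \<in> set ` set (lex_subsets n r)"
    by (auto simp: set_conv_nth length_lex_subsets)
  also have "set ` set (lex_subsets n r) = (\<lambda>I. set (sorted_list_of_set I)) ` ?S"
    unfolding lex_subsets_def set_sorted_list_of_set[OF fin] by (simp add: image_image)
  also have "\<dots> = id ` ?S"
    by (rule image_cong) (auto dest: finite_subset)
  finally show ?thesis by (simp add: atLeast0LessThan)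
qed

lemma nonneg_entries_compound_iff:
  "nonneg_entries (compound r X) \<longleftrightarrow> (\<forall>R C. index_map r (dim_row X) R \<longrightarrow> index_map r (dim_col X) C \<longrightarrow>
     0 \<le> minor r (\<lambda>i j. X $$ (i, j)) R C)"
proof -
  let ?I = "\<lambda>i. set (lex_subsets (dim_row X) r ! i)" and ?J = "\<lambda>j. set (lex_subsets (dim_col X) r ! j)"
  have I: "?I i \<subseteq> {..<dim_row X} \<and> card (?I i) = r" if "i < dim_row X choose r" for i
    by (rule iffD1[OF lex_subsets_nth]) (use that in blast)
  have J: "?J j \<subseteq> {..<dim_col X} \<and> card (?J j) = r" if "j < dim_col X choose r" for j
    by (rule iffD1[OF lex_subsets_nth]) (use that in blast)
  have nn: "nonneg_entries (compound r X) \<longleftrightarrow> (\<forall>i<dim_row X choose r. \<forall>j<dim_col X choose r.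
      0 \<le> det (submatrix X (?I i) (?J j)))"
    by (auto simp: nonneg_entries_def compound_def)
  show ?thesis
    unfolding nn
  proof (intro iffI allI impI)
    fix R C
    assume L: "\<forall>i<dim_row X choose r. \<forall>j<dim_col X choose r. 0 \<le> det (submatrix X (?I i) (?J j))"
      and R: "index_map r (dim_row X) R" and C: "index_map r (dim_col X) C"
    obtain i where i: "i < dim_row X choose r" "?I i = R ` {..<r}"
      using iffD2[OF lex_subsets_nth index_map_image[OF R]] by blast
    obtain j where j: "j < dim_col X choose r" "?J j = C ` {..<r}"
      using iffD2[OF lex_subsets_nth index_map_image[OF C]] by blast
    have "0 \<le> det (submatrix X (?I i) (?J j))" using L i(1) j(1) by blast
    also have "\<dots> = minor r (\<lambda>i j. X $$ (i, j)) R C"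
      using I[OF i(1)] J[OF j(1)] by (subst det_submatrix_eq_minor[of _ _ r])
        (simp_all add: i(2) j(2) minor_pick[OF R C])
    finally show "0 \<le> minor r (\<lambda>i j. X $$ (i, j)) R C" .
  next
    fix i j
    assume M: "\<forall>R C. index_map r (dim_row X) R \<longrightarrow> index_map r (dim_col X) C \<longrightarrow>
        0 \<le> minor r (\<lambda>i j. X $$ (i, j)) R C"
      and ij: "i < dim_row X choose r" "j < dim_col X choose r"
    then show "0 \<le> det (submatrix X (?I i) (?J j))"
      using I[OF ij(1)] J[OF ij(2)]
      by (subst det_submatrix_eq_minor[of _ _ r]) (auto intro: index_map_pick)
  qed
qed

lemma nonneg_entries_compound_transpose:
  "nonneg_entries (compound r (transpose_mat X)) \<longleftrightarrow> nonneg_entries (compound r X)"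
proof -
  have "minor r (\<lambda>i j. transpose_mat X $$ (i, j)) C R = minor r (\<lambda>i j. X $$ (i, j)) R C"
    if "index_map r (dim_row X) R" "index_map r (dim_col X) C" for R C
    by (subst minor_transpose, rule minor_cong)
      (use index_map_less[OF that(1)] index_map_less[OF that(2)] in simp)
  then show ?thesis
    unfolding nonneg_entries_compound_iff by auto
qed

text \<open>A minor that meets the zero padding has a zero row or column.\<close>

lemma all_minors_nonneg_pad:
  assumes "\<And>i j. i \<notin> I \<Longrightarrow> M i j = 0" "\<And>i j. j \<notin> J \<Longrightarrow> M i j = 0"
  shows "all_minors_nonneg k UNIV UNIV M \<longleftrightarrow> all_minors_nonneg k I J M"
proof
  assume M: "all_minors_nonneg k I J M"
  show "all_minors_nonneg k UNIV UNIV M"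
    unfolding all_minors_nonneg_def
  proof (intro allI impI)
    fix r and R C :: "nat \<Rightarrow> nat"
    assume rc: "r \<le> k" "strict_mono_on {..<r} R" "strict_mono_on {..<r} C"
    consider i where "i < r" "R i \<notin> I" | j where "j < r" "C j \<notin> J"
      | "R ` {..<r} \<subseteq> I" "C ` {..<r} \<subseteq> J" by blast
    then show "0 \<le> minor r M R C"
    proof cases
      case 1
      then show ?thesis by (simp add: minor_zero_row[of i] assms(1))
    next
      case 2
      then show ?thesis by (simp add: minor_zero_col[of j] assms(2))
    next
      case 3
      then show ?thesis using M rc unfolding all_minors_nonneg_def by blast
    qed
  qed
qed (auto simp: all_minors_nonneg_def)

lemma all_minors_nonneg_cong:
  assumes "\<And>i j. i \<in> I \<Longrightarrow> j \<in> J \<Longrightarrow> M i j = M' i j"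
  shows "all_minors_nonneg k I J M \<longleftrightarrow> all_minors_nonneg k I J M'"
proof -
  have "minor r M R C = minor r M' R C" if "R ` {..<r} \<subseteq> I" "C ` {..<r} \<subseteq> J" for r R C
    by (rule minor_cong) (use that assms in auto)
  then show ?thesis unfolding all_minors_nonneg_def by auto
qed

lemma all_minors_nonneg_transpose:
  "all_minors_nonneg k UNIV UNIV (\<lambda>i j. M j i) \<longleftrightarrow> all_minors_nonneg k UNIV UNIV M"
  unfolding all_minors_nonneg_def using minor_transpose[of _ M] by auto

lemma nonneg_entries_compounds_iff:
  "(\<forall>j\<in>{1..k}. nonneg_entries (compound j X)) \<longleftrightarrow>
    all_minors_nonneg k {..<dim_row X} {..<dim_col X} (\<lambda>i j. X $$ (i, j))"
proof -
  have "nonneg_entries (compound 0 X)" by (simp add: nonneg_entries_compound_iff)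
  then have "(\<forall>j\<in>{1..k}. nonneg_entries (compound j X)) \<longleftrightarrow> (\<forall>j\<le>k. nonneg_entries (compound j X))"
    by (metis atLeastAtMost_iff le_zero_eq not_less_eq_eq One_nat_def)
  also have "\<dots> \<longleftrightarrow> all_minors_nonneg k {..<dim_row X} {..<dim_col X} (\<lambda>i j. X $$ (i, j))"
    unfolding nonneg_entries_compound_iff all_minors_nonneg_def index_map_def
    by (intro all_cong) auto
  finally show ?thesis .
qed

section \<open>Krylov matrices of the system and of its dual\<close>

lemma pow_mat_commute:
  assumes "(A :: real mat) \<in> carrier_mat n n"
  shows "A * A ^\<^sub>m t = A ^\<^sub>m t * A"
proof (induction t)
  case (Suc t)
  have "A * A ^\<^sub>m Suc t = (A * A ^\<^sub>m t) * A"
    using assms by (simp add: assoc_mult_mat[of A n n "A ^\<^sub>m t" n A n])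
  then show ?case using Suc by simp
qed (use assms in simp)

lemma transpose_pow_mat:
  assumes "(A :: real mat) \<in> carrier_mat n n"
  shows "transpose_mat (A ^\<^sub>m t) = transpose_mat A ^\<^sub>m t"
proof (induction t)
  case (Suc t)
  have "transpose_mat (A ^\<^sub>m Suc t) = transpose_mat A * transpose_mat (A ^\<^sub>m t)"
    using assms by (simp add: transpose_mult[of _ n n _ n])
  also have "\<dots> = transpose_mat A ^\<^sub>m Suc t"
    using Suc pow_mat_commute[of "transpose_mat A" n t] assms by simp
  finally show ?case .
qed (use assms in simp)

text \<open>The infinite controllability matrix, padded by zero rows so that it matches states read
  through \<open>vec_seq\<close>.\<close>

definition krylov :: "real mat \<Rightarrow> real mat \<Rightarrow> nat \<Rightarrow> nat \<Rightarrow> real" where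
  "krylov A b i t = (if i < dim_row A then (A ^\<^sub>m t * b) $$ (i, 0) else 0)"

text \<open>Matrix powers unfold with the new factor on the right; commuting it to the left yields
  the recursion for \<open>Krylov_minors_nonneg\<close>.\<close>

lemma krylov_Suc:
  assumes A: "A \<in> carrier_mat n n" and b: "b \<in> carrier_mat n 1" and "i < n"
  shows "krylov A b i (Suc t) = (\<Sum>l<n. A $$ (i, l) * krylov A b l t)"
proof -
  have "A ^\<^sub>m Suc t * b = A * (A ^\<^sub>m t * b)"
    using A b by (simp add: pow_mat_commute[OF A, symmetric] assoc_mult_mat[of A n n "A ^\<^sub>m t" n b 1])
  moreover have "(A * (A ^\<^sub>m t * b)) $$ (i, 0) = (\<Sum>l<n. A $$ (i, l) * (A ^\<^sub>m t * b) $$ (l, 0))"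
    using A b assms(3) by (simp add: scalar_prod_def atLeast0LessThan del: index_mult_mat(1))
      (simp add: scalar_prod_def atLeast0LessThan)
  ultimately show ?thesis using A assms(3) by (simp add: krylov_def)
qed

lemma index_map_self:
  assumes "index_map r r C" "i < r"
  shows "C i = i"
proof -
  have "C ` {..<r} = (\<lambda>i. i) ` {..<r}"
    using index_map_image[OF assms(1)] by (intro card_subset_eq) auto
  then show ?thesis
    using pick_strict_mono_image[of r C i] pick_strict_mono_image[of r "\<lambda>i. i" i] assms
    by (simp add: index_map_def strict_mono_on_def)
qed

text \<open>With exactly \<open>r\<close> columns available, the only increasing choice of
  \<open>r\<close> columns is the identity, so the compound is a single column.\<close>

lemma nonneg_entries_compound_ctrb_mat:
  assumes "A \<in> carrier_mat n n"
  shows "nonneg_entries (compound r (ctrb_mat r A b)) \<longleftrightarrow>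
    (\<forall>R. index_map r n R \<longrightarrow> 0 \<le> minor r (krylov A b) R (\<lambda>j. j))"
proof -
  have eq: "minor r (\<lambda>i j. ctrb_mat r A b $$ (i, j)) R C = minor r (krylov A b) R (\<lambda>j. j)"
    if "index_map r n R" "index_map r r C" for R C
    using assms that by (intro minor_cong) (simp add: ctrb_mat_def krylov_def index_map_self index_map_less)
  have id: "index_map r r (\<lambda>j. j)" by (auto simp: index_map_def strict_mono_on_def)
  have dim: "dim_row (ctrb_mat r A b) = n" "dim_col (ctrb_mat r A b) = r"
    using assms by (auto simp: ctrb_mat_def)
  show ?thesis
    unfolding nonneg_entries_compound_iff dim using eq id by metis
qed

lemma krylov_minors_nonneg_iff:
  assumes A: "A \<in> carrier_mat n n" and b: "b \<in> carrier_mat n 1"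
    and A_nn: "all_minors_nonneg k {..<n} {..<n} (\<lambda>i j. A $$ (i, j))"
  shows "all_minors_nonneg k UNIV UNIV (krylov A b) \<longleftrightarrow>
    (\<forall>r\<in>{1..k}. nonneg_entries (compound r (ctrb_mat r A b)))"
proof -
  have pad: "all_minors_nonneg k UNIV UNIV (krylov A b) \<longleftrightarrow> all_minors_nonneg k {..<n} UNIV (krylov A b)"
    by (rule all_minors_nonneg_pad) (use A in \<open>auto simp: krylov_def\<close>)
  show ?thesis
    unfolding pad nonneg_entries_compound_ctrb_mat[OF A]
  proof
    assume K: "all_minors_nonneg k {..<n} UNIV (krylov A b)"
    show "\<forall>r\<in>{1..k}. \<forall>R. index_map r n R \<longrightarrow> 0 \<le> minor r (krylov A b) R (\<lambda>j. j)"
    proof (intro ballI allI impI)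
      fix r R assume "r \<in> {1..k}" "index_map r n R"
      then show "0 \<le> minor r (krylov A b) R (\<lambda>j. j)"
        by (intro all_minors_nonnegD[OF K]) (auto simp: index_map_def strict_mono_on_def)
    qed
  next
    assume init: "\<forall>r\<in>{1..k}. \<forall>R. index_map r n R \<longrightarrow> 0 \<le> minor r (krylov A b) R (\<lambda>j. j)"
    show "all_minors_nonneg k {..<n} UNIV (krylov A b)"
    proof (rule Krylov_minors_nonneg[OF _ A_nn])
      show "krylov A b i (Suc t) = (\<Sum>l<n. A $$ (i, l) * krylov A b l t)" if "i < n" for i t
        using krylov_Suc[OF A b that] .
      fix r R assume "r \<le> k" "index_map r n R"
      then show "0 \<le> minor r (krylov A b) R (\<lambda>j. j)"
        using init by (cases "r = 0") auto
    qed
  qed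
qed

text \<open>For \<open>\<rho>\<close> midway between the spectral radius and 1, the matrix
  \<open>A\<close> divided by \<open>\<rho>\<close> still has spectral radius below 1. Its powers
  are bounded, and scaling back gives geometric decay.\<close>

lemma stable_pow_bound:
  assumes A: "A \<in> carrier_mat n n" and "stable A"
  obtains K \<rho> where "0 < \<rho>" "\<rho> < 1"
    "\<And>t i j. i < n \<Longrightarrow> j < n \<Longrightarrow> \<bar>(A ^\<^sub>m t) $$ (i, j)\<bar> \<le> K * \<rho> ^ t"
proof (cases "n = 0")
  case True
  then show ?thesis using that[of "1/2" 0] by simp
next
  case False
  then have n: "0 < n" by simp
  let ?A = "map_mat complex_of_real A"
  have cA: "?A \<in> carrier_mat n n" using A by simp
  define r where "r = spectral_radius ?A"
  have "r \<in> norm ` spectrum ?A"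
    unfolding r_def by (rule spectral_radius_mem_max(1)[OF cA n])
  then have r: "0 \<le> r" "r < 1"
    using \<open>stable A\<close> by (auto simp: stable_def spectrum_def)
  define \<rho> where "\<rho> = (1 + r) / 2"
  have \<rho>: "0 < \<rho>" "\<rho> < 1" "r < \<rho>" using r by (auto simp: \<rho>_def)
  define s where "s = complex_of_real (1 / \<rho>)"
  let ?B = "s \<cdot>\<^sub>m ?A"
  have s: "complex_of_real \<rho> * s = 1" using \<rho> by (simp add: s_def)
  have B: "?B \<in> carrier_mat n n" using cA by simp
  have "spectral_radius ?B < 1"
  proof -
    obtain \<mu> where \<mu>: "eigenvalue ?B \<mu>" "spectral_radius ?B = norm \<mu>"
      using spectral_radius_mem_max(1)[OF B n] by (auto simp: spectrum_def)
    obtain v where v: "v \<in> carrier_vec n" "v \<noteq> 0\<^sub>v n" "?B *\<^sub>v v = \<mu> \<cdot>\<^sub>v v"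
      using \<mu>(1) B by (auto simp: eigenvalue_def eigenvector_def)
    have "?A *\<^sub>v v = (complex_of_real \<rho> * \<mu>) \<cdot>\<^sub>v v"
    proof (rule eq_vecI)
      fix i assume "i < dim_vec ((complex_of_real \<rho> * \<mu>) \<cdot>\<^sub>v v)"
      then have i: "i < n" using v(1) by simp
      have "s * (?A *\<^sub>v v) $ i = (?B *\<^sub>v v) $ i"
        using i A v(1) by (simp add: scalar_prod_def sum_distrib_left mult_ac)
      also have "\<dots> = \<mu> * v $ i" unfolding v(3) using i v(1) by simp
      finally have "complex_of_real \<rho> * (s * (?A *\<^sub>v v) $ i) = complex_of_real \<rho> * (\<mu> * v $ i)"
        by simp
      then show "(?A *\<^sub>v v) $ i = ((complex_of_real \<rho> * \<mu>) \<cdot>\<^sub>v v) $ i"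
        unfolding mult.assoc[symmetric] s using i v(1) by simp
    qed (use A v(1) in simp)
    then have "eigenvalue ?A (complex_of_real \<rho> * \<mu>)"
      using v A by (auto simp: eigenvalue_def eigenvector_def)
    then have "norm (complex_of_real \<rho> * \<mu>) \<le> r"
      unfolding r_def by (intro spectral_radius_mem_max(2)[OF cA n]) (auto simp: spectrum_def)
    then have "\<rho> * norm \<mu> \<le> r"
      using \<rho>(1) by (simp add: norm_mult)
    then have "\<rho> * norm \<mu> < \<rho> * 1"
      using \<rho>(3) by linarith
    then show ?thesis
      unfolding \<mu>(2) mult_less_cancel_left_pos[OF \<rho>(1)] .
  qed
  then obtain K where K: "\<And>t. norm_bound (?B ^\<^sub>m t) K"
    using spectral_radius_jnf_norm_bound_less_1_upper_triangular[OF B] by blast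
  have pow: "?B ^\<^sub>m t = s ^ t \<cdot>\<^sub>m map_mat complex_of_real (A ^\<^sub>m t)" for t
  proof (induction t)
    case 0
    show ?case using A by (auto intro!: eq_matI)
  next
    case (Suc t)
    let ?P = "map_mat complex_of_real (A ^\<^sub>m t)"
    have P: "?P \<in> carrier_mat n n" using A by simp
    have "?B ^\<^sub>m Suc t = (s ^ t \<cdot>\<^sub>m ?P) * (s \<cdot>\<^sub>m ?A)" using Suc by simp
    also have "\<dots> = s ^ t \<cdot>\<^sub>m (?P * (s \<cdot>\<^sub>m ?A))"
      by (rule mult_smult_assoc_mat[OF P B])
    also have "?P * (s \<cdot>\<^sub>m ?A) = s \<cdot>\<^sub>m (?P * ?A)"
      by (rule mult_smult_distrib[OF P cA])
    also have "?P * ?A = map_mat complex_of_real (A ^\<^sub>m Suc t)"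
      unfolding pow_mat.simps by (rule of_real_hom.mat_hom_mult[symmetric]) (use A in auto)
    finally show ?case by (auto intro!: eq_matI)
  qed
  have "\<bar>(A ^\<^sub>m t) $$ (i, j)\<bar> \<le> K * \<rho> ^ t" if "i < n" "j < n" for t i j
  proof -
    have "norm ((?B ^\<^sub>m t) $$ (i, j)) \<le> K"
      using K[of t] that unfolding norm_bound_def pow_mat_dim_square[OF B] by blast
    then have "norm (s ^ t * complex_of_real ((A ^\<^sub>m t) $$ (i, j))) \<le> K"
      unfolding pow using that A by simp
    then have "\<bar>(A ^\<^sub>m t) $$ (i, j)\<bar> / \<rho> ^ t \<le> K"
      using \<rho>(1) by (simp add: s_def norm_mult norm_power norm_divide power_one_over field_simps)
    then show ?thesis
      using \<rho>(1) by (simp add: pos_divide_le_eq)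
  qed
  then show ?thesis using that \<rho> by blast
qed

text \<open>Geometric decay against a bounded input gives absolute convergence, so the unordered sum
  over negative times equals the series in the order of \<open>past_seq\<close>.\<close>

lemma krylov_sums_ctrb_op:
  assumes A: "A \<in> carrier_mat n n" and b: "b \<in> carrier_mat n 1" and "stable A"
    and u: "u \<in> past_inputs"
  shows "(\<lambda>t. krylov A b i t * past_seq u t) sums vec_seq (ctrb_op A b u) i"
proof (cases "i < n")
  case False
  then show ?thesis using A by (simp add: krylov_def vec_seq_def ctrb_op_def)
next
  case True
  obtain B where B: "\<And>t. t \<le> -1 \<Longrightarrow> \<bar>u t\<bar> \<le> B"
    using u by (auto simp: past_inputs_def bounded_iff)
  obtain K \<rho> where \<rho>: "0 < \<rho>" "\<rho> < 1"
    and K: "\<And>t i j. i < n \<Longrightarrow> j < n \<Longrightarrow> \<bar>(A ^\<^sub>m t) $$ (i, j)\<bar> \<le> K * \<rho> ^ t"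
    by (rule stable_pow_bound[OF A \<open>stable A\<close>]) blast
  let ?f = "\<lambda>t. krylov A b i t * past_seq u t"
  let ?c = "\<Sum>l<n. K * \<bar>b $$ (l, 0)\<bar>"
  have bound: "norm (?f t) \<le> ?c * B * \<rho> ^ t" for t
  proof -
    have "krylov A b i t = (\<Sum>l<n. (A ^\<^sub>m t) $$ (i, l) * b $$ (l, 0))"
      using A b True by (simp add: krylov_def scalar_prod_def atLeast0LessThan)
    then have "\<bar>krylov A b i t\<bar> \<le> (\<Sum>l<n. K * \<rho> ^ t * \<bar>b $$ (l, 0)\<bar>)"
      using K[OF True] by (auto simp: abs_mult intro!: sum_abs[THEN order_trans] sum_mono mult_right_mono)
    also have "\<dots> = ?c * \<rho> ^ t"
      by (simp add: sum_distrib_left mult_ac)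
    finally have "\<bar>krylov A b i t\<bar> \<le> ?c * \<rho> ^ t" .
    moreover have "\<bar>past_seq u t\<bar> \<le> B" using B by (simp add: past_seq_def)
    ultimately have "\<bar>krylov A b i t\<bar> * \<bar>past_seq u t\<bar> \<le> (?c * \<rho> ^ t) * B"
      by (intro mult_mono) auto
    then show ?thesis by (simp add: abs_mult mult_ac)
  qed
  have summ: "summable (\<lambda>t. norm (?f t))"
    by (rule summable_comparison_test'[of "\<lambda>t. ?c * B * \<rho> ^ t" 0])
      (use bound \<rho> in \<open>auto intro!: summable_mult summable_geometric\<close>)
  then have sums: "?f sums suminf ?f"
    by (rule summable_sums[OF summable_norm_cancel])
  have bij: "bij_betw (\<lambda>t. - 1 - int t) UNIV {..-1}"
    by (rule bij_betw_byWitness[where f' = "\<lambda>t. nat (- t - 1)"]) auto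
  have "vec_seq (ctrb_op A b u) i = (\<Sum>\<^sub>\<infinity>t\<in>{..-1}. (A ^\<^sub>m nat (- t - 1) * b) $$ (i, 0) * u t)"
    using True A by (simp add: vec_seq_def ctrb_op_def)
  also have "\<dots> = (\<Sum>\<^sub>\<infinity>t. (A ^\<^sub>m nat (- (- 1 - int t) - 1) * b) $$ (i, 0) * u (- 1 - int t))"
    by (rule infsum_reindex_bij_betw[OF bij, symmetric])
  also have "\<dots> = infsum ?f UNIV"
    using True A by (simp add: krylov_def past_seq_def)
  also have "\<dots> = suminf ?f"
    by (rule infsumI[OF norm_summable_imp_has_sum[OF summ sums]])
  finally show ?thesis using sums by simp
qed

section \<open>The three operators as infinite matrices\<close>

lemma vec_seq_surj:
  assumes "{j. v j \<noteq> 0} \<subseteq> {..<n}"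
  shows "v \<in> vec_seq ` carrier_vec n"
proof
  show "v = vec_seq (vec n v)" using assms by (auto simp: vec_seq_def fun_eq_iff)
qed simp

lemma finite_support_sums_vec_seq:
  assumes "x \<in> carrier_vec n" "\<And>j. j < n \<Longrightarrow> f j = g j" "s = (\<Sum>j<n. g j * x $ j)"
  shows "(\<lambda>j. f j * vec_seq x j) sums s"
proof -
  have "(\<lambda>j. f j * vec_seq x j) sums (\<Sum>j<n. f j * vec_seq x j)"
    by (rule sums_finite) (use assms in \<open>auto simp: vec_seq_def\<close>)
  also have "(\<Sum>j<n. f j * vec_seq x j) = s"
    unfolding assms(3) using assms(1,2) by (intro sum.cong) (auto simp: vec_seq_def)
  finally show ?thesis .
qed

lemma ovd_matrix_iff:
  assumes A: "A \<in> carrier_mat n n"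
  shows "ovd m (carrier_vec (dim_row A)) vec_seq vec_seq (\<lambda>x. A *\<^sub>v x) \<longleftrightarrow>
    all_minors_nonneg (Suc m) {..<n} {..<n} (\<lambda>i j. A $$ (i, j))"
proof -
  let ?M = "\<lambda>i j. if i < n \<and> j < n then A $$ (i, j) else 0"
  have "(\<lambda>j. ?M i j * vec_seq x j) sums vec_seq (A *\<^sub>v x) i" if "x \<in> carrier_vec n" for x i
    by (rule finite_support_sums_vec_seq[OF that refl])
      (use A that in \<open>auto simp: vec_seq_def scalar_prod_def atLeast0LessThan\<close>)
  then have "ovd m (carrier_vec n) vec_seq vec_seq (\<lambda>x. A *\<^sub>v x) \<longleftrightarrow> all_minors_nonneg (Suc m) UNIV UNIV ?M"
    by (intro ovd_iff_minors_nonneg[where J = "{..<n}"] vec_seq_surj) auto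
  also have "\<dots> \<longleftrightarrow> all_minors_nonneg (Suc m) {..<n} {..<n} ?M"
    by (rule all_minors_nonneg_pad) auto
  also have "\<dots> \<longleftrightarrow> all_minors_nonneg (Suc m) {..<n} {..<n} (\<lambda>i j. A $$ (i, j))"
    by (rule all_minors_nonneg_cong) auto
  finally show ?thesis using A by simp
qed

lemma ovd_ctrb_op_iff:
  assumes A: "A \<in> carrier_mat n n" and b: "b \<in> carrier_mat n 1" and "stable A"
  shows "ovd m past_inputs past_seq vec_seq (ctrb_op A b) \<longleftrightarrow> all_minors_nonneg (Suc m) UNIV UNIV (krylov A b)"
proof (rule ovd_iff_minors_nonneg[where J = UNIV])
  \<comment> \<open>A finitely supported sequence has finite range, hence is the sequence of a
    bounded past input.\<close>
  fix v :: "nat \<Rightarrow> real" assume "finite {j. v j \<noteq> 0}"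
  then have "finite (insert 0 (v ` {j. v j \<noteq> 0}))" by simp
  then have "finite (range v)" by (rule rev_finite_subset) auto
  then have "bounded ((\<lambda>t. v (nat (- t - 1))) ` {..- 1 :: int})"
    by (rule finite_imp_bounded[OF finite_subset[rotated]]) auto
  moreover have "v = past_seq (\<lambda>t. v (nat (- t - 1)))"
    by (simp add: past_seq_def fun_eq_iff)
  ultimately show "v \<in> past_seq ` past_inputs"
    by (auto simp: past_inputs_def)
qed (use krylov_sums_ctrb_op[OF A b \<open>stable A\<close>] in auto)

text \<open>The matrix of this operator has times as rows and states as columns: it is the transpose
  of the Krylov matrix of the dual pair, with the same minors.\<close>

lemma ovd_obsv_op_iff:
  assumes A: "A \<in> carrier_mat n n" and c: "c \<in> carrier_mat 1 n"
  shows "ovd m (carrier_vec (dim_row A)) vec_seq (\<lambda>y. y) (obsv_op A c) \<longleftrightarrow>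
    all_minors_nonneg (Suc m) UNIV UNIV (krylov (transpose_mat A) (transpose_mat c))"
proof -
  let ?K = "krylov (transpose_mat A) (transpose_mat c)"
  have K: "?K j t = (c * A ^\<^sub>m t) $$ (0, j)" if "j < n" for j t
  proof -
    have "transpose_mat A ^\<^sub>m t * transpose_mat c = transpose_mat (c * A ^\<^sub>m t)"
      using A c by (simp add: transpose_pow_mat[OF A] transpose_mult[of _ 1 n _ n])
    then show ?thesis using that A c by (simp add: krylov_def del: index_mult_mat(1))
  qed
  have "(\<lambda>j. ?K j t * vec_seq x j) sums obsv_op A c x t" if "x \<in> carrier_vec n" for x t
  proof (rule finite_support_sums_vec_seq[OF that K])
    show "obsv_op A c x t = (\<Sum>j<n. (c * A ^\<^sub>m t) $$ (0, j) * x $ j)"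
      using A c that by (simp add: obsv_op_def scalar_prod_def[of _ x] atLeast0LessThan del: index_mult_mat(1))
  qed
  then have "ovd m (carrier_vec n) vec_seq (\<lambda>y. y) (obsv_op A c) \<longleftrightarrow>
      all_minors_nonneg (Suc m) UNIV UNIV (\<lambda>t j. ?K j t)"
    by (intro ovd_iff_minors_nonneg[where J = "{..<n}"] vec_seq_surj) (use A in \<open>auto simp: krylov_def\<close>)
  also have "\<dots> \<longleftrightarrow> all_minors_nonneg (Suc m) UNIV UNIV ?K"
    by (rule all_minors_nonneg_transpose[of _ ?K])
  finally show ?thesis using A by simp
qed

theorem theorem3p2:
  fixes A b c :: "real mat" and n k :: nat
  assumes "A \<in> carrier_mat n n" and "b \<in> carrier_mat n 1" and "c \<in> carrier_mat 1 n"
    and "stable A"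
    and "1 \<le> k" and "k \<le> n"
  shows "internally_Hankel_positive k A b c \<longleftrightarrow>
    (\<forall>j\<in>{1..k}. internally_positive
       (compound j A) (compound j (ctrb_mat j A b)) (compound j (obsv_mat j A c)))"
proof -
  note A = assms(1) and b = assms(2) and c = assms(3)
  have AT: "transpose_mat A \<in> carrier_mat n n" and cT: "transpose_mat c \<in> carrier_mat n 1"
    using A c by auto
  have k: "Suc (k - 1) = k" using assms(5) by simp
  let ?A = "\<forall>j\<in>{1..k}. nonneg_entries (compound j A)"
  let ?C = "\<lambda>A b. \<forall>j\<in>{1..k}. nonneg_entries (compound j (ctrb_mat j A b))"
  have minors_A: "?A \<longleftrightarrow> all_minors_nonneg k {..<n} {..<n} (\<lambda>i j. A $$ (i, j))"
    and minors_AT: "?A \<longleftrightarrow> all_minors_nonneg k {..<n} {..<n} (\<lambda>i j. transpose_mat A $$ (i, j))"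
    using A nonneg_entries_compounds_iff[of k A] nonneg_entries_compounds_iff[of k "transpose_mat A"]
    by (simp_all add: nonneg_entries_compound_transpose)
  \<comment> \<open>Nonnegativity of a compound is invariant under transposition, so the
    observability condition becomes the controllability condition of the dual pair.\<close>
  have "internally_positive (compound j A) (compound j (ctrb_mat j A b)) (compound j (obsv_mat j A c)) \<longleftrightarrow>
      nonneg_entries (compound j A) \<and> nonneg_entries (compound j (ctrb_mat j A b)) \<and>
      nonneg_entries (compound j (ctrb_mat j (transpose_mat A) (transpose_mat c)))" for j
    unfolding obsv_mat_def nonneg_entries_compound_transpose[of j "ctrb_mat j (transpose_mat A) (transpose_mat c)", symmetric]
    by (rule internally_positive_iff[where N = "n choose j"])
      (use A in \<open>simp_all add: compound_def ctrb_mat_def\<close>)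
  then have "(\<forall>j\<in>{1..k}. internally_positive
      (compound j A) (compound j (ctrb_mat j A b)) (compound j (obsv_mat j A c))) \<longleftrightarrow>
      ?A \<and> ?C A b \<and> ?C (transpose_mat A) (transpose_mat c)" by blast
  also have "\<dots> \<longleftrightarrow> ?A \<and> all_minors_nonneg k UNIV UNIV (krylov A b) \<and>
      all_minors_nonneg k UNIV UNIV (krylov (transpose_mat A) (transpose_mat c))"
    using krylov_minors_nonneg_iff[OF A b, of k] krylov_minors_nonneg_iff[OF AT cT, of k]
      minors_A minors_AT by blast
  also have "\<dots> \<longleftrightarrow> internally_Hankel_positive k A b c"
    unfolding internally_Hankel_positive_def ovd_matrix_iff[OF A] ovd_ctrb_op_iff[OF A b \<open>stable A\<close>]
      ovd_obsv_op_iff[OF A c] k minors_A ..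
  finally show ?thesis ..
qed

end
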